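(* Let $\bar u=\{u_1,\dots,u_n\}$ and $\bar v=\{v_1,\dots,v_n\}$ be sets of (generic) complex parameters with $\#\bar u=\#\bar v=n$. Consider the multiple action of the transfer matrix on the off-shell Bethe vector, $$ t(\bar v)\,\mathbb{B}(\bar u)=\sum R(\bar v\,|\,\bar\eta_{\rm I},\bar\eta_{\rm II})\;\mathbb{B}(\bar\eta_{\rm II}),\qquad \bar\eta=\{\bar u,\bar v\},$$ where the sum is taken over partitions of $\bar\eta$ into two disjoint subsets $\bar\eta_{\rm I},\bar\eta_{\rm II}$ such that $\#\bar\eta_{\rm I}=\#\bar\eta_{\rm II}$. Then the coefficient of $\mathbb{B}(\bar v)$ in this multiple action coincides with the (Slavnov formula for the) scalar product of on-shell and off-shell Bethe vectors: $$ S(\bar v|\bar u)\equiv \mathbb{C}(\bar v)\,\mathbb{B}(\bar u)=R(\bar v\,|\,\bar u,\bar v),$$ where the set $\bar v$ satisfies the Bethe equations $$\frac{\lambda_1(v_i)}{\lambda_2(v_i)}=\prod_{j\ne i}\frac{f(v_i,v_j)}{f(v_j,v_i)},\qquad i=1,\dots,n,$$ and the set $\bar u$ is free (off-shell).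
   Context: Let $c$ be a nonzero complex constant and put $g(u,v)=\frac{c}{u-v}$, $f(u,v)=\frac{u-v+c}{u-v}$. Let $R(u,v)=\mathbf 1\otimes\mathbf 1+g(u,v)\mathbf P$ on $\mathbb{C}^2\otimes\mathbb{C}^2$, with $\mathbf P$ the permutation operator. The monodromy matrix $T(u)=(T_{ij}(u))_{i,j=1,2}$ has entries that are operators on a space $\mathcal H$ and satisfies $$R(u,v)\,T^{(1)}(u)\,T^{(2)}(v)=T^{(2)}(v)\,T^{(1)}(u)\,R(u,v),$$ where $T^{(i)}$ acts in the $i$-th tensor factor. Consequently $[T_{ij}(u),T_{ij}(v)]=0$, and the transfer matrix $t(u)=T_{11}(u)+T_{22}(u)$ satisfies $[t(u),t(v)]=0$. There are a vacuum $|0\rangle\in\mathcal H$ and a dual vacuum $\langle 0|\in\mathcal H^*$ (with $\langle0|0\rangle=1$) such that $T_{ii}(u)|0\rangle=\lambda_i(u)|0\rangle$, $T_{21}(u)|0\rangle=0$, $\langle0|T_{ii}(u)=\lambda_i(u)\langle0|$, $\langle0|T_{12}(u)=0$. The complex-valued functions $\lambda_1,\lambda_2$ are treated as free functional parameters (generalized model): no specific form of them is assumed. For a set $\bar u=\{u_1,\dots,u_n\}$, $\bar u_j=\bar u\setminus\{u_j\}$. A function, or a family of commuting operators, with a set as argument means the product over that set; e.g. $f(z,\bar u)=\prod_i f(z,u_i)$, $t(\bar v)=\prod_i t(v_i)$; empty products equal $1$. Bethe vectors: $\mathbb{B}(\bar u)=T_{12}(u_1)\cdots T_{12}(u_n)|0\rangle$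 (symmetric in $\bar u$). Dual Bethe vectors: $\mathbb{C}(\bar v)=\langle0|T_{21}(v_1)\cdots T_{21}(v_n)$. Single action of the transfer matrix (known fact): $$t(z)\,\mathbb{B}(\bar u)=\tau(z|\bar u)\,\mathbb{B}(\bar u)+\sum_j g(z,u_j)\bigl(\lambda_1(u_j)f(\bar u_j,u_j)-\lambda_2(u_j)f(u_j,\bar u_j)\bigr)\mathbb{B}(\{z\}\cup\bar u_j),$$ $$\tau(z|\bar u)=\lambda_1(z)f(\bar u,z)+\lambda_2(z)f(z,\bar u).$$ The coefficients $R(\bar v|\bar\eta_{\rm I},\bar\eta_{\rm II})$ are those obtained by applying this formula successively for $z=v_1,\dots,v_n$ to $\mathbb{B}(\bar u)$ and collecting the total coefficient of each $\mathbb{B}(\bar\eta_{\rm II})$; $R(\bar v|\bar u,\bar v)$ is the total coefficient of $\mathbb{B}(\bar v)$.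
   Formalization: The formal equality is C(v)B(u) = λ₂(v₁)…λ₂(v_n)·R(v|u,v); without this factor the claim fails, already for n=1, where C(v)B(u) = λ₂(v)g(v,u)(λ₁(u)−λ₂(u)) on shell. It reduces to the stated formula when the product of the λ₂(v_i) is 1. *)

theory Defs
  imports "HOL-Analysis.Analysis"
begin

definition g_fun :: "complex \<Rightarrow> complex \<Rightarrow> complex \<Rightarrow> complex" where
  "g_fun c u v = c / (u - v)"

definition f_fun :: "complex \<Rightarrow> complex \<Rightarrow> complex \<Rightarrow> complex" where
  "f_fun c u v = (u - v + c) / (u - v)"


(* An operator on C^2 (x) C^2 (x) H is encoded as a block matrix: rows and columns are
   indexed by pairs of basis indices of the two C^2 factors (elements of the two-element
   type 2, written 1 and 2), and the entries are operators on H. *)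

type_synonym 'h block_op = "2 \<times> 2 \<Rightarrow> 2 \<times> 2 \<Rightarrow> 'h \<Rightarrow> 'h"

definition block_mult :: "'h::comm_monoid_add block_op \<Rightarrow> 'h block_op \<Rightarrow> 'h block_op" where
  "block_mult A B = (\<lambda>a b x. \<Sum>e\<in>UNIV. A a e (B e b x))"

definition permutation_matrix :: "2 \<times> 2 \<Rightarrow> 2 \<times> 2 \<Rightarrow> complex" where
  "permutation_matrix a b = (if a = prod.swap b then 1 else 0)"

definition R_matrix :: "complex \<Rightarrow> complex \<Rightarrow> complex \<Rightarrow> 2 \<times> 2 \<Rightarrow> 2 \<times> 2 \<Rightarrow> complex" where
  "R_matrix c u v a b = (if a = b then 1 else 0) + g_fun c u v * permutation_matrix a b"

definition scalar_block ::
    "(complex \<Rightarrow> 'h \<Rightarrow> 'h) \<Rightarrow> (2 \<times> 2 \<Rightarrow> 2 \<times> 2 \<Rightarrow> complex) \<Rightarrow> 'h block_op" where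
  "scalar_block cscale M = (\<lambda>a b. cscale (M a b))"

definition first_factor :: "(2 \<Rightarrow> 2 \<Rightarrow> 'h \<Rightarrow> 'h) \<Rightarrow> 'h::zero block_op" where
  "first_factor M = (\<lambda>(i, j) (k, l) x. if j = l then M i k x else 0)"

definition second_factor :: "(2 \<Rightarrow> 2 \<Rightarrow> 'h \<Rightarrow> 'h) \<Rightarrow> 'h::zero block_op" where
  "second_factor M = (\<lambda>(i, j) (k, l) x. if i = k then M j l x else 0)"


(* T i j u is the entry T_ij(u) of the monodromy matrix and lam i is the function lambda_i.
   The RTT relation is imposed only away from the pole u = v of R(u,v): at u = v the
   convention x / 0 = 0 would turn it into a false commutation relation. *)

locale generalized_model = vector_space cscale
  for cscale :: "complex \<Rightarrow> 'h::ab_group_add \<Rightarrow> 'h" +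
  fixes c :: complex
    and T :: "2 \<Rightarrow> 2 \<Rightarrow> complex \<Rightarrow> 'h \<Rightarrow> 'h"
    and vac :: 'h
    and dual_vac :: "'h \<Rightarrow> complex"
    and lam :: "2 \<Rightarrow> complex \<Rightarrow> complex"
  assumes c_nonzero: "c \<noteq> 0"
    and T_linear: "Vector_Spaces.linear cscale cscale (T i j u)"
    and RTT: "u \<noteq> v \<Longrightarrow>
      block_mult (scalar_block cscale (R_matrix c u v))
        (block_mult (first_factor (\<lambda>i j. T i j u)) (second_factor (\<lambda>i j. T i j v)))
      = block_mult (block_mult (second_factor (\<lambda>i j. T i j v)) (first_factor (\<lambda>i j. T i j u)))
          (scalar_block cscale (R_matrix c u v))"
    and T_diag_vac: "T i i u vac = cscale (lam i u) vac"
    and T21_vac: "T 2 1 u vac = 0"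
    and dual_vac_linear: "Vector_Spaces.linear cscale (*) dual_vac"
    and dual_vac_T_diag: "dual_vac (T i i u x) = lam i u * dual_vac x"
    and dual_vac_T12: "dual_vac (T 1 2 u x) = 0"
    and dual_vac_vac: "dual_vac vac = 1"

definition transfer_matrix ::
    "(2 \<Rightarrow> 2 \<Rightarrow> complex \<Rightarrow> 'h \<Rightarrow> 'h) \<Rightarrow> complex \<Rightarrow> 'h \<Rightarrow> 'h::ab_group_add" where
  "transfer_matrix T u x = T 1 1 u x + T 2 2 u x"

(* Product of a family A of operators over a finite set S, applied to x.  The fold is
   independent of the order because it is only used for commuting families. *)

definition op_prod :: "(complex \<Rightarrow> 'h \<Rightarrow> 'h) \<Rightarrow> complex set \<Rightarrow> 'h \<Rightarrow> 'h" where
  "op_prod A S x = Finite_Set.fold A x S"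

definition bethe_vector ::
    "(2 \<Rightarrow> 2 \<Rightarrow> complex \<Rightarrow> 'h \<Rightarrow> 'h) \<Rightarrow> 'h \<Rightarrow> complex set \<Rightarrow> 'h" where
  "bethe_vector T vac S = op_prod (T 1 2) S vac"

definition dual_bethe_vector ::
    "(2 \<Rightarrow> 2 \<Rightarrow> complex \<Rightarrow> 'h \<Rightarrow> 'h) \<Rightarrow> ('h \<Rightarrow> complex) \<Rightarrow> complex set \<Rightarrow> 'h \<Rightarrow> complex" where
  "dual_bethe_vector T dual_vac S x = dual_vac (op_prod (T 2 1) S x)"


definition tau :: "complex \<Rightarrow> (2 \<Rightarrow> complex \<Rightarrow> complex) \<Rightarrow> complex \<Rightarrow> complex set \<Rightarrow> complex" where
  "tau c lam z S = lam 1 z * (\<Prod>u\<in>S. f_fun c u z) + lam 2 z * (\<Prod>u\<in>S. f_fun c z u)"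

(* Coefficient of B({z} \<union> S - {w}) in t(z) B(S). *)

definition exchange_coeff ::
    "complex \<Rightarrow> (2 \<Rightarrow> complex \<Rightarrow> complex) \<Rightarrow> complex \<Rightarrow> complex set \<Rightarrow> complex \<Rightarrow> complex" where
  "exchange_coeff c lam z S w = g_fun c z w *
     (lam 1 w * (\<Prod>u\<in>S - {w}. f_fun c u w) - lam 2 w * (\<Prod>u\<in>S - {w}. f_fun c w u))"

(* Total coefficient of B(S') after applying the single action formula to B(S) successively
   for z running through the list, head first. *)

fun iterated_coeff ::
    "complex \<Rightarrow> (2 \<Rightarrow> complex \<Rightarrow> complex) \<Rightarrow> complex list \<Rightarrow> complex set \<Rightarrow> complex set \<Rightarrow> complex" where
  "iterated_coeff c lam [] S S' = (if S' = S then 1 else 0)"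
| "iterated_coeff c lam (z # zs) S S' =
     tau c lam z S * iterated_coeff c lam zs S S'
     + (\<Sum>w\<in>S. exchange_coeff c lam z S w * iterated_coeff c lam zs (insert z (S - {w})) S')"

(* R(v | eta_I, eta_II): the starting set u is recovered as the complement of v in
   eta = eta_I \<union> eta_II.  These coefficients are homogeneous in (lambda_1, lambda_2) of degree
   #v, whereas the scalar product C(v) B(u) is homogeneous of degree 2 #v; comparing the two
   for operators that are not normalized to lambda_2 = 1 takes a factor lambda_2(v). *)

definition multiple_action_coeff ::
    "complex \<Rightarrow> (2 \<Rightarrow> complex \<Rightarrow> complex) \<Rightarrow> complex list \<Rightarrow> complex set \<Rightarrow> complex set \<Rightarrow> complex" where
  "multiple_action_coeff c lam vs \<eta>\<^sub>I \<eta>\<^sub>I\<^sub>I =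
     iterated_coeff c lam vs ((\<eta>\<^sub>I \<union> \<eta>\<^sub>I\<^sub>I) - set vs) \<eta>\<^sub>I\<^sub>I"

(* The first two conjuncts say that no denominator in the equations vanishes. *)

definition bethe_equations :: "complex \<Rightarrow> (2 \<Rightarrow> complex \<Rightarrow> complex) \<Rightarrow> complex set \<Rightarrow> bool" where
  "bethe_equations c lam V \<longleftrightarrow>
     (\<forall>v\<in>V. lam 2 v \<noteq> 0) \<and>
     (\<forall>v\<in>V. \<forall>w\<in>V - {v}. f_fun c w v \<noteq> 0) \<and>
     (\<forall>v\<in>V. lam 1 v / lam 2 v = (\<Prod>w\<in>V - {v}. f_fun c v w / f_fun c w v))"

end

theory Submission
  imports Defs
begin

text \<open>
  Write \<open>K(V|A)\<close> for the partition function with domain wall boundary. In Korepin's expansion of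
  the off-shell scalar product, split \<open>V = V\<^sub>1 \<union> V\<^sub>2\<close> and \<open>U = A \<union> B\<close>; the summand is
  \<open>\<lambda>\<^sub>1(A) \<lambda>\<^sub>2(B) \<lambda>\<^sub>1(V\<^sub>1) \<lambda>\<^sub>2(V\<^sub>2) f(B,A) f(V\<^sub>2,V\<^sub>1) K(V\<^sub>2|A) K'(V\<^sub>1|B)\<close>, where \<open>K'\<close> is \<open>K\<close> with \<open>c\<close>
  replaced by \<open>-c\<close>. The Bethe equations turn \<open>\<lambda>\<^sub>1(V\<^sub>1) f(V\<^sub>2,V\<^sub>1)\<close> into \<open>\<lambda>\<^sub>2(V\<^sub>1) f(V\<^sub>1,V\<^sub>2)\<close>, so that
  \<open>\<lambda>\<^sub>2(V)\<close> factors out. The remaining sum over \<open>V\<^sub>1\<close> satisfies a one-step recursion in \<open>V\<close>: by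
  partial fractions, the poles at coinciding elements of \<open>V\<close> cancel. After an exchange of the order of
  two steps, this is the recursion of the coefficient of \<open>B(V)\<close> under successive action of the transfer
  matrix: each of the \<open>n\<close> actions has to replace an element of \<open>U\<close>, hence the eigenvalue terms
  \<open>\<tau>\<close> and the exchanges among elements of \<open>V\<close> do not contribute.
\<close>

section \<open>Sums over subsets and rational identities\<close>

lemma sum_Pow_insert:
  fixes h :: "'a set \<Rightarrow> 'b::comm_monoid_add"
  assumes "finite A" "x \<notin> A"
  shows "sum h (Pow (insert x A)) = (\<Sum>B\<in>Pow A. h B + h (insert x B))"
proof -
  have inj: "inj_on (insert x) (Pow A)"
    using assms by (intro inj_onI) (auto simp: insert_eq_iff)
  have "sum h (Pow (insert x A)) = sum h (Pow A) + sum h (insert x ` Pow A)"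
    unfolding Pow_insert using assms by (intro sum.union_disjoint) auto
  also have "sum h (insert x ` Pow A) = (\<Sum>B\<in>Pow A. h (insert x B))"
    using inj by (simp add: sum.reindex)
  finally show ?thesis by (simp add: sum.distrib)
qed

lemma sum_Pow_member:
  fixes F :: "'a set \<Rightarrow> 'a \<Rightarrow> 'b::comm_monoid_add"
  assumes "finite U"
  shows "(\<Sum>A\<in>Pow U. \<Sum>w\<in>A. F A w) = (\<Sum>w\<in>U. \<Sum>A\<in>Pow (U - {w}). F (insert w A) w)"
proof -
  have "(\<Sum>A\<in>Pow U. \<Sum>w\<in>A. F A w) = (\<Sum>(A, w)\<in>Sigma (Pow U) (\<lambda>A. A). F A w)"
    using assms by (subst sum.Sigma) (auto intro: finite_subset)
  also have "\<dots> = (\<Sum>(w, A)\<in>Sigma U (\<lambda>w. Pow (U - {w})). F (insert w A) w)"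
    by (rule sum.reindex_bij_witness[where i = "\<lambda>(w, A). (insert w A, w)"
        and j = "\<lambda>(A, w). (w, A - {w})"]) (auto simp: insert_absorb)
  also have "\<dots> = (\<Sum>w\<in>U. \<Sum>A\<in>Pow (U - {w}). F (insert w A) w)"
    using assms by (subst sum.Sigma) auto
  finally show ?thesis .
qed

lemma sum_Pow_nonmember:
  fixes F :: "'a set \<Rightarrow> 'a \<Rightarrow> 'b::comm_monoid_add"
  assumes "finite U"
  shows "(\<Sum>A\<in>Pow U. \<Sum>w\<in>U - A. F A w) = (\<Sum>w\<in>U. \<Sum>A\<in>Pow (U - {w}). F A w)"
proof -
  have "(\<Sum>A\<in>Pow U. \<Sum>w\<in>U - A. F A w) = (\<Sum>(A, w)\<in>Sigma (Pow U) (\<lambda>A. U - A). F A w)"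
    using assms by (subst sum.Sigma) auto
  also have "\<dots> = (\<Sum>(w, A)\<in>Sigma U (\<lambda>w. Pow (U - {w})). F A w)"
    by (rule sum.reindex_bij_witness[where i = "\<lambda>(w, A). (A, w)" and j = "\<lambda>(A, w). (w, A)"]) auto
  also have "\<dots> = (\<Sum>w\<in>U. \<Sum>A\<in>Pow (U - {w}). F A w)"
    using assms by (subst sum.Sigma) auto
  finally show ?thesis .
qed

lemma sum_swap_distinct:
  fixes F :: "'a \<Rightarrow> 'a \<Rightarrow> 'b::comm_monoid_add"
  assumes "finite A"
  shows "(\<Sum>x\<in>A. \<Sum>y\<in>A - {x}. F x y) = (\<Sum>y\<in>A. \<Sum>x\<in>A - {y}. F x y)"
proof -
  have "(\<Sum>x\<in>A. \<Sum>y\<in>A - {x}. F x y) = (\<Sum>(x, y)\<in>Sigma A (\<lambda>x. A - {x}). F x y)"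
    using assms by (subst sum.Sigma) auto
  also have "\<dots> = (\<Sum>(y, x)\<in>Sigma A (\<lambda>y. A - {y}). F x y)"
    by (rule sum.reindex_bij_witness[where i = prod.swap and j = prod.swap]) auto
  also have "\<dots> = (\<Sum>y\<in>A. \<Sum>x\<in>A - {y}. F x y)"
    using assms by (subst sum.Sigma) auto
  finally show ?thesis .
qed

section \<open>Rational identities for \<open>g_fun\<close> and \<open>f_fun\<close>\<close>

lemma g_fun_uminus [simp]: "g_fun (- c) u v = - g_fun c u v"
  by (simp add: g_fun_def)

text \<open>
  The sign change of \<open>c\<close> exchanges the arguments of \<open>f\<close>; together with an exchange of \<open>\<lambda>\<^sub>1\<close> and
  \<open>\<lambda>\<^sub>2\<close> it is a symmetry of all formulas, so that statements are proved for one of the two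
  functions only.
\<close>

lemma f_fun_uminus [simp]: "f_fun (- c) u v = f_fun c v u"
  by (cases "u = v") (auto simp: f_fun_def field_simps)

lemma g_fun_swap: "g_fun c v u = - g_fun c u v"
  by (cases "u = v") (auto simp: g_fun_def field_simps)

lemma f_fun_eq_g_fun: "u \<noteq> v \<Longrightarrow> f_fun c u v = 1 + g_fun c u v"
  by (simp add: f_fun_def g_fun_def field_simps)

text \<open>The Arnold relation. With a = x - y and b = y - z it is 1/(ab) = (1/a + 1/b)/(a + b).
  Nearly all coefficient comparisons below reduce to it once f is written as 1 + g.\<close>

lemma g_fun_mult_g_fun:
  assumes "x \<noteq> y" "y \<noteq> z" "x \<noteq> z"
  shows "g_fun c x y * g_fun c y z = g_fun c x z * (g_fun c x y + g_fun c y z)"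
proof -
  define a b where "a = x - y" and "b = y - z"
  have "a \<noteq> 0" "b \<noteq> 0" "a + b \<noteq> 0" and xz: "x - z = a + b"
    using assms by (auto simp: a_def b_def)
  then show ?thesis
    unfolding g_fun_def xz a_def[symmetric] b_def[symmetric] by (simp add: divide_simps) (simp add: algebra_simps)
qed

text \<open>After f = 1 + g on both sides, the terms linear in g agree and the quadratic ones are
  the Arnold relation. It merges the two ways in which an element \<open>w\<close> can be exchanged
  for \<open>z\<close> when \<open>u\<close> stands in front.\<close>

lemma exchange_identity:
  assumes "u \<noteq> z" "z \<noteq> w" "u \<noteq> w"
  shows "f_fun c u z * g_fun c z w + g_fun c z u * g_fun c u w = g_fun c z w * f_fun c u w"
  using assms g_fun_mult_g_fun[of z u w c] g_fun_swap[of c u z]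
  by (simp add: f_fun_eq_g_fun algebra_simps)

text \<open>This is the symmetry in \<open>x\<close>, \<open>y\<close> of the partition function
  with two elements on each side. All six differences are expressed through three independent ones,
  so that clearing denominators leaves a polynomial identity.\<close>

lemma dwpf_swap_identity:
  assumes "x \<noteq> y" "x \<noteq> w" "x \<noteq> w'" "y \<noteq> w" "y \<noteq> w'" "w \<noteq> w'"
  shows "g_fun c x w * f_fun c y w * g_fun c y w' * f_fun c w w'
       + g_fun c x w' * f_fun c y w' * g_fun c y w * f_fun c w' w
     = g_fun c y w * f_fun c x w * g_fun c x w' * f_fun c w w'
       + g_fun c y w' * f_fun c x w' * g_fun c x w * f_fun c w' w"
proof -
  define p q d where "p = x - w" and "q = y - w" and "d = w - w'"
  have nz: "p \<noteq> 0" "q \<noteq> 0" "d \<noteq> 0" "p + d \<noteq> 0" "q + d \<noteq> 0"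
    and eqs: "x - w = p" "y - w = q" "x - w' = p + d" "y - w' = q + d" "w - w' = d" "w' - w = - d"
    using assms by (auto simp: p_def q_def d_def)
  show ?thesis
    unfolding g_fun_def f_fun_def eqs using nz by (simp add: divide_simps) algebra
qed


section \<open>Domain wall partition functions\<close>

abbreviation f_left :: "complex \<Rightarrow> complex set \<Rightarrow> complex \<Rightarrow> complex" where
  "f_left c A x \<equiv> (\<Prod>a\<in>A. f_fun c a x)"

abbreviation f_right :: "complex \<Rightarrow> complex \<Rightarrow> complex set \<Rightarrow> complex" where
  "f_right c x A \<equiv> (\<Prod>a\<in>A. f_fun c x a)"

text \<open>
  Izergin's determinant, given by the partial fraction expansion in one element of \<open>V\<close>. The value
  is \<open>0\<close> unless \<open>V\<close> and \<open>A\<close> have the same cardinality, so no sum below needs a cardinality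
  condition.
\<close>

fun dwpf_list :: "complex \<Rightarrow> complex list \<Rightarrow> complex set \<Rightarrow> complex" where
  "dwpf_list c [] A = (if A = {} then 1 else 0)"
| "dwpf_list c (v # vs) A =
     (\<Sum>w\<in>A. g_fun c v w * f_left c (set vs) w * f_right c w (A - {w}) * dwpf_list c vs (A - {w}))"

text \<open>Removing two elements at once gives a double sum over ordered pairs
  \<open>(w, w')\<close>. The summand is a factor \<open>m\<close> that depends on the order of
  \<open>x\<close> and \<open>y\<close>, times a factor \<open>s\<close> symmetric in
  \<open>w\<close> and \<open>w'\<close>. Symmetrizing in the pair, which doubles the sum, leaves
  exactly \<open>dwpf_swap_identity\<close>.\<close>

lemma dwpf_list_swap:
  assumes "finite A" "x \<noteq> y" "x \<notin> A" "y \<notin> A" "x \<notin> set vs" "y \<notin> set vs"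
  shows "dwpf_list c (x # y # vs) A = dwpf_list c (y # x # vs) A"
proof -
  let ?R = "\<lambda>w w'. A - {w} - {w'}"
  define s where "s w w' = f_left c (set vs) w * f_left c (set vs) w'
    * f_right c w (?R w w') * f_right c w' (?R w w') * dwpf_list c vs (?R w w')" for w w'
  have s_sym: "s w w' = s w' w" for w w'
    by (simp add: s_def Diff_insert2[symmetric] insert_commute)
  define m where "m x y w w' = g_fun c x w * f_fun c y w * g_fun c y w' * f_fun c w w'" for x y w w'
  have expand: "dwpf_list c (a # b # vs) A = (\<Sum>w\<in>A. \<Sum>w'\<in>A - {w}. m a b w w' * s w w')"
    if "b \<notin> set vs" for a b
  proof -
    have "f_right c w (A - {w}) = f_fun c w w' * f_right c w (?R w w')"
      if "w \<in> A" "w' \<in> A - {w}" for w w'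
      using that assms by (subst prod.remove[of _ w']) auto
    then show ?thesis
      using that by (auto simp: sum_distrib_left s_def m_def mult_ac intro!: sum.cong)
  qed
  have double: "2 * dwpf_list c (a # b # vs) A = (\<Sum>w\<in>A. \<Sum>w'\<in>A - {w}. (m a b w w' + m a b w' w) * s w w')"
    if "b \<notin> set vs" for a b
  proof -
    have "dwpf_list c (a # b # vs) A = (\<Sum>w\<in>A. \<Sum>w'\<in>A - {w}. m a b w' w * s w w')"
      unfolding expand[OF that] by (subst sum_swap_distinct) (simp_all add: assms s_sym)
    with expand[OF that, of a] show ?thesis
      by (simp add: algebra_simps sum.distrib)
  qed
  have "m x y w w' + m x y w' w = m y x w w' + m y x w' w" if "w \<in> A" "w' \<in> A - {w}" for w w'
    unfolding m_def using that assms by (intro dwpf_swap_identity) auto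
  then have "2 * dwpf_list c (x # y # vs) A = 2 * dwpf_list c (y # x # vs) A"
    unfolding double[OF assms(5)] double[OF assms(6)] by (intro sum.cong refl) simp
  then show ?thesis by simp
qed

lemma dwpf_list_move_front:
  assumes "finite A" "distinct (as @ x # bs)" "set (as @ x # bs) \<inter> A = {}"
  shows "dwpf_list c (as @ x # bs) A = dwpf_list c (x # as @ bs) A"
  using assms
proof (induction as arbitrary: A)
  case (Cons a as)
  have "dwpf_list c (as @ x # bs) (A - {w}) = dwpf_list c (x # as @ bs) (A - {w})" for w
    using Cons.prems by (intro Cons.IH) auto
  then have "dwpf_list c ((a # as) @ x # bs) A = dwpf_list c (a # x # as @ bs) A"
    by simp
  also have "\<dots> = dwpf_list c (x # a # as @ bs) A"
    using Cons.prems by (intro dwpf_list_swap) auto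
  finally show ?case by simp
qed simp

lemma dwpf_list_perm:
  assumes "finite A" "distinct xs" "distinct ys" "set xs = set ys" "set xs \<inter> A = {}"
  shows "dwpf_list c xs A = dwpf_list c ys A"
  using assms
proof (induction xs arbitrary: A ys)
  case (Cons x xs)
  then obtain as bs where ys: "ys = as @ x # bs"
    by (metis list.set_intros(1) split_list)
  have set_eq: "set xs = set (as @ bs)"
    using Cons.prems unfolding ys by auto
  have "dwpf_list c xs (A - {w}) = dwpf_list c (as @ bs) (A - {w})" for w
    using Cons.prems set_eq unfolding ys by (intro Cons.IH) auto
  then have "dwpf_list c (x # xs) A = dwpf_list c (x # as @ bs) A"
    using set_eq by simp
  also have "\<dots> = dwpf_list c ys A"
    using Cons.prems unfolding ys by (intro dwpf_list_move_front[symmetric]) auto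
  finally show ?case .
qed simp

text \<open>The enumeration is an arbitrary choice. By \<open>dwpf_list_perm\<close> the value does
  not depend on it when \<open>V\<close> is finite and disjoint from the finite set
  \<open>A\<close>.\<close>

definition dwpf :: "complex \<Rightarrow> complex set \<Rightarrow> complex set \<Rightarrow> complex" where
  "dwpf c V A = dwpf_list c (SOME vs. distinct vs \<and> set vs = V) A"

lemma dwpf_set:
  assumes "finite A" "distinct vs" "set vs \<inter> A = {}"
  shows "dwpf c (set vs) A = dwpf_list c vs A"
proof -
  have "\<exists>ws. distinct ws \<and> set ws = set vs"
    using assms by blast
  then show ?thesis
    unfolding dwpf_def using someI_ex[of "\<lambda>ws. distinct ws \<and> set ws = set vs"] assms
    by (intro dwpf_list_perm) auto
qed

lemma dwpf_empty: "finite A \<Longrightarrow> dwpf c {} A = (if A = {} then 1 else 0)"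
  using dwpf_set[of A "[]"] by simp

lemma dwpf_insert:
  assumes "finite V" "finite A" "v \<notin> V" "insert v V \<inter> A = {}"
  shows "dwpf c (insert v V) A =
    (\<Sum>w\<in>A. g_fun c v w * f_left c V w * f_right c w (A - {w}) * dwpf c V (A - {w}))"
proof -
  obtain vs where vs: "set vs = V" "distinct vs"
    using finite_distinct_list[OF assms(1)] by blast
  have "dwpf c (set vs) (A - {w}) = dwpf_list c vs (A - {w})" for w
    using assms vs by (intro dwpf_set) auto
  moreover have "dwpf c (set (v # vs)) A = dwpf_list c (v # vs) A"
    using assms vs by (intro dwpf_set) auto
  ultimately show ?thesis
    using vs by simp
qed

text \<open>
  Here \<open>v\<close> is the first element to be paired, in \<open>dwpf_insert\<close> the last one; the two agree because
  \<open>dwpf\<close> is symmetric in \<open>V\<close>.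
\<close>

lemma dwpf_insert':
  assumes "finite V" "finite A" "v \<notin> V" "insert v V \<inter> A = {}"
  shows "dwpf c (insert v V) A =
    (\<Sum>w\<in>A. g_fun c v w * f_left c (A - {w}) w * f_right c v (A - {w}) * dwpf c V (A - {w}))"
  using assms
proof (induction V arbitrary: A rule: finite_induct)
  case empty
  \<comment> \<open>\<open>dwpf c {} B\<close> vanishes unless \<open>B\<close> is empty, and then
    every product over \<open>B\<close> is 1. This lets one product over \<open>B\<close> replace
    another.\<close>
  have single: "f_right c w B * dwpf c {} B = f_left c B w * (f_right c v B * dwpf c {} B)"
    if "finite B" for B w
    using that by (cases "B = {}") (auto simp: dwpf_empty)
  have "dwpf c {v} A = (\<Sum>w\<in>A. g_fun c v w * f_right c w (A - {w}) * dwpf c {} (A - {w}))"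
    using empty by (subst dwpf_insert) auto
  also have "\<dots> = (\<Sum>w\<in>A. g_fun c v w * f_left c (A - {w}) w * f_right c v (A - {w}) * dwpf c {} (A - {w}))"
    using empty by (intro sum.cong refl) (simp only: mult.assoc, subst single, simp_all)
  finally show ?case .
next
  case (insert y V)
  let ?R = "\<lambda>w w'. A - {w} - {w'}"
  have "dwpf c (insert v (insert y V)) A = dwpf c (insert y (insert v V)) A"
    by (simp add: insert_commute)
  also have "\<dots> = (\<Sum>w'\<in>A. g_fun c y w' * f_left c (insert v V) w' * f_right c w' (A - {w'})
      * dwpf c (insert v V) (A - {w'}))"
    using insert by (subst dwpf_insert) auto
  also have "\<dots> = (\<Sum>w'\<in>A. g_fun c y w' * f_left c (insert v V) w' * f_right c w' (A - {w'})
      * (\<Sum>w\<in>A - {w'}. g_fun c v w * f_left c (?R w' w) w * f_right c v (?R w' w) * dwpf c V (?R w' w)))"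
    using insert by (intro sum.cong refl, subst insert.IH) auto
  \<comment> \<open>So far \<open>y\<close> was removed by \<open>dwpf_insert\<close> and then
    \<open>v\<close> by the induction hypothesis. Exchanging the sums puts \<open>v\<close> outside,
    and the inner sum over \<open>w'\<close> becomes the recursion that removes \<open>y\<close>
    from \<open>insert y V\<close>.\<close>
  also have "\<dots> = (\<Sum>w\<in>A. \<Sum>w'\<in>A - {w}. g_fun c y w' * f_left c (insert v V) w' * f_right c w' (A - {w'})
      * (g_fun c v w * f_left c (?R w' w) w * f_right c v (?R w' w) * dwpf c V (?R w' w)))"
    unfolding sum_distrib_left using insert by (intro sum_swap_distinct)
  also have "\<dots> = (\<Sum>w\<in>A. \<Sum>w'\<in>A - {w}. g_fun c v w * f_left c (A - {w}) w * f_right c v (A - {w})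
      * (g_fun c y w' * f_left c V w' * f_right c w' (?R w w') * dwpf c V (?R w w')))"
  proof (intro sum.cong refl)
    fix w w' assume w: "w \<in> A" "w' \<in> A - {w}"
    define R where "R = ?R w w'"
    have "finite R" "w \<notin> R" "w' \<notin> R" "w \<noteq> w'"
      using w insert.prems by (auto simp: R_def)
    moreover have "A - {w} = insert w' R" "A - {w'} = insert w R" "?R w' w = R" "?R w w' = R"
      using w by (auto simp: R_def)
    ultimately show "g_fun c y w' * f_left c (insert v V) w' * f_right c w' (A - {w'})
      * (g_fun c v w * f_left c (?R w' w) w * f_right c v (?R w' w) * dwpf c V (?R w' w))
      = g_fun c v w * f_left c (A - {w}) w * f_right c v (A - {w})
      * (g_fun c y w' * f_left c V w' * f_right c w' (?R w w') * dwpf c V (?R w w'))"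
      using insert by simp
  qed
  also have "\<dots> = (\<Sum>w\<in>A. g_fun c v w * f_left c (A - {w}) w * f_right c v (A - {w})
      * dwpf c (insert y V) (A - {w}))"
    unfolding sum_distrib_left[symmetric]
    using insert by (intro sum.cong refl, subst dwpf_insert) auto
  finally show ?case .
qed

text \<open>Induction on \<open>V\<close>: remove \<open>y\<close> from the partition functions on
  the right. If \<open>y\<close> is paired with some \<open>w'\<close> in \<open>A\<close>, the
  induction hypothesis sums over \<open>w\<close>; if it is paired with \<open>x\<close>, the sum
  over \<open>w\<close> is a partition function with \<open>x\<close> in place of \<open>y\<close>.
  The lemma serves to bring a new element into the second argument of a partition function.\<close>

lemma dwpf_exchange:
  assumes "finite V" "finite A" "x \<notin> V" "x \<notin> A" "V \<inter> A = {}"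
  shows "(f_left c V x - f_left c A x) * dwpf c V A =
    (\<Sum>w\<in>A. g_fun c x w * f_left c (A - {w}) w * dwpf c V (insert x (A - {w})))"
  using assms
proof (induction V arbitrary: A rule: finite_induct)
  case empty
  then show ?case by (auto simp: dwpf_empty)
next
  case (insert y V)
  let ?R = "\<lambda>w w'. A - {w} - {w'}"
  have fin: "finite A" and xy: "x \<noteq> y" and disj: "x \<notin> A" "y \<notin> A" "V \<inter> A = {}" "x \<notin> V"
    using insert by auto
  \<comment> \<open>Up to sign, \<open>D\<close> collects the terms with \<open>y\<close> paired
    with \<open>x\<close>. Its sum is a multiple of \<open>dwpf c (insert x V) A\<close> by
    \<open>dwpf_insert'\<close>. Expanding the same value by \<open>dwpf_insert\<close> instead
    gives \<open>D'\<close>, whose summands carry the same factors as those coming from the other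
    pairings.\<close>
  define D where "D w = g_fun c x y * f_left c V x * g_fun c x w * f_left c (A - {w}) w
      * f_right c x (A - {w}) * dwpf c V (A - {w})" for w
  define D' where "D' w = g_fun c x y * f_left c V x * g_fun c x w * f_left c V w
      * f_right c w (A - {w}) * dwpf c V (A - {w})" for w
  have "dwpf c (insert x V) A = (\<Sum>w\<in>A. g_fun c x w * f_left c (A - {w}) w * f_right c x (A - {w}) * dwpf c V (A - {w}))"
    using insert by (intro dwpf_insert') auto
  then have D: "(\<Sum>w\<in>A. D w) = g_fun c x y * f_left c V x * dwpf c (insert x V) A"
    by (simp add: D_def sum_distrib_left mult_ac)
  have "dwpf c (insert x V) A = (\<Sum>w\<in>A. g_fun c x w * f_left c V w * f_right c w (A - {w}) * dwpf c V (A - {w}))"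
    using insert by (intro dwpf_insert) auto
  then have D': "(\<Sum>w\<in>A. D' w) = g_fun c x y * f_left c V x * dwpf c (insert x V) A"
    by (simp add: D'_def sum_distrib_left mult_ac)
  define P where "P w w' = g_fun c y w' * f_left c V w' * f_right c w' (A - {w'}) * f_fun c w' x
      * (g_fun c x w * f_left c (?R w' w) w * dwpf c V (insert x (?R w' w)))" for w w'
  have "(\<Sum>w\<in>A. g_fun c x w * f_left c (A - {w}) w * dwpf c (insert y V) (insert x (A - {w})))
    = (\<Sum>w\<in>A. (\<Sum>w'\<in>A - {w}. P w w') - D w)"
  proof (intro sum.cong refl)
    fix w assume w: "w \<in> A"
    have xA: "insert x (A - {w}) - {x} = A - {w}"
      using disj by auto
    have "dwpf c (insert y V) (insert x (A - {w})) =
      (\<Sum>w'\<in>insert x (A - {w}). g_fun c y w' * f_left c V w' * f_right c w' (insert x (A - {w}) - {w'})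
        * dwpf c V (insert x (A - {w}) - {w'}))"
      using insert w by (subst dwpf_insert) auto
    also have "\<dots> = g_fun c y x * f_left c V x * f_right c x (A - {w}) * dwpf c V (A - {w})
      + (\<Sum>w'\<in>A - {w}. g_fun c y w' * f_left c V w' * f_right c w' (insert x (A - {w}) - {w'})
        * dwpf c V (insert x (A - {w}) - {w'}))"
      using fin disj by (subst sum.insert) (auto simp: xA)
    finally have *: "dwpf c (insert y V) (insert x (A - {w})) = \<dots>" .
    have "g_fun c x w * f_left c (A - {w}) w * (g_fun c y w' * f_left c V w' * f_right c w' (insert x (A - {w}) - {w'})
        * dwpf c V (insert x (A - {w}) - {w'})) = P w w'" if w': "w' \<in> A - {w}" for w'
    proof -
      define R where "R = ?R w w'"
      have R: "finite R" "w \<notin> R" "w' \<notin> R" "w \<noteq> w'" "x \<notin> R" "x \<noteq> w" "x \<noteq> w'"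
        using w w' insert.prems by (auto simp: R_def)
      moreover have "A - {w} = insert w' R" "A - {w'} = insert w R" "?R w' w = R" "?R w w' = R"
        "insert x (A - {w}) - {w'} = insert x R"
        using w w' disj by (auto simp: R_def)
      ultimately show ?thesis
        unfolding P_def by simp
    qed
    then show "g_fun c x w * f_left c (A - {w}) w * dwpf c (insert y V) (insert x (A - {w}))
      = (\<Sum>w'\<in>A - {w}. P w w') - D w"
      unfolding * distrib_left sum_distrib_left by (simp add: D_def g_fun_swap[of c y x])
  qed
  also have "\<dots> = (\<Sum>w'\<in>A. \<Sum>w\<in>A - {w'}. P w w') - (\<Sum>w\<in>A. D' w)"
    unfolding sum_subtractf D D' using fin by (subst sum_swap_distinct) auto
  also have "(\<Sum>w'\<in>A. \<Sum>w\<in>A - {w'}. P w w') = (\<Sum>w'\<in>A. g_fun c y w' * f_left c V w' * f_right c w' (A - {w'})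
      * f_fun c w' x * ((f_left c V x - f_left c (A - {w'}) x) * dwpf c V (A - {w'})))"
    unfolding P_def sum_distrib_left[symmetric]
    using insert by (intro sum.cong refl, subst insert.IH) auto
  also have "\<dots> - (\<Sum>w\<in>A. D' w) = (\<Sum>w\<in>A. (f_left c (insert y V) x - f_left c A x)
      * (g_fun c y w * f_left c V w * f_right c w (A - {w}) * dwpf c V (A - {w})))"
    unfolding sum_subtractf[symmetric]
  proof (intro sum.cong refl)
    fix w assume w: "w \<in> A"
    then have "x \<noteq> w" "y \<noteq> w" using disj by auto
    \<comment> \<open>The only scalar computation of the induction step; with f = 1 + g it is the
      Arnold relation for \<open>x\<close>, \<open>y\<close>, \<open>w\<close>.\<close>
    with xy have "f_fun c w x * g_fun c y w - g_fun c x y * g_fun c x w = f_fun c y x * g_fun c y w"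
      using exchange_identity[of w x y c] g_fun_swap[of c x y] g_fun_swap[of c x w] g_fun_swap[of c y w]
        f_fun_eq_g_fun[of w x c] f_fun_eq_g_fun[of y x c] g_fun_mult_g_fun[of x y w c]
      by (simp add: algebra_simps)
    moreover have "f_left c A x = f_fun c w x * f_left c (A - {w}) x"
      using w fin by (simp add: prod.remove)
    moreover have "f_left c (insert y V) x = f_fun c y x * f_left c V x"
      using insert by simp
    ultimately show "g_fun c y w * f_left c V w * f_right c w (A - {w})
      * f_fun c w x * ((f_left c V x - f_left c (A - {w}) x) * dwpf c V (A - {w})) - D' w
      = (f_left c (insert y V) x - f_left c A x)
      * (g_fun c y w * f_left c V w * f_right c w (A - {w}) * dwpf c V (A - {w}))"
      unfolding D'_def by algebra
  qed
  also have "\<dots> = (f_left c (insert y V) x - f_left c A x) * dwpf c (insert y V) A"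
    unfolding sum_distrib_left[symmetric] using insert by (subst dwpf_insert[of V A y]) auto
  finally show ?case by simp
qed


section \<open>Convolutions of partition functions\<close>

text \<open>As a function of \<open>v\<close> the product has simple poles at the elements of
  \<open>V\<close> and tends to 1 at infinity. The coefficient at the pole \<open>y\<close> is the
  product of the other factors evaluated at \<open>y\<close>.\<close>

lemma f_left_partial_fractions:
  assumes "finite V" "v \<notin> V"
  shows "f_left c V v = 1 + (\<Sum>y\<in>V. g_fun c y v * f_left c (V - {y}) y)"
  using assms
proof (induction V arbitrary: v rule: finite_induct)
  case (insert x V)
  have "(\<Sum>y\<in>insert x V. g_fun c y v * f_left c (insert x V - {y}) y)
    = g_fun c x v * f_left c V x + (\<Sum>y\<in>V. g_fun c y v * f_left c (insert x V - {y}) y)"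
    using insert by (simp add: insert_Diff_if)
  also have "(\<Sum>y\<in>V. g_fun c y v * f_left c (insert x V - {y}) y)
    = (\<Sum>y\<in>V. f_fun c x v * (g_fun c y v * f_left c (V - {y}) y) - g_fun c x v * (g_fun c y x * f_left c (V - {y}) y))"
  proof (intro sum.cong refl)
    fix y assume y: "y \<in> V"
    then have "insert x V - {y} = insert x (V - {y})" and ne: "x \<noteq> y" "y \<noteq> v"
      using insert by auto
    then have "f_left c (insert x V - {y}) y = f_fun c x y * f_left c (V - {y}) y"
      using insert by simp
    moreover have "f_fun c x y * g_fun c y v = f_fun c x v * g_fun c y v - g_fun c x v * g_fun c y x"
      using exchange_identity[of x y v c] ne insert g_fun_mult_g_fun[of x y v c]
      by (auto simp: f_fun_eq_g_fun g_fun_swap[of c y x] algebra_simps)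
    ultimately show "g_fun c y v * f_left c (insert x V - {y}) y
      = f_fun c x v * (g_fun c y v * f_left c (V - {y}) y) - g_fun c x v * (g_fun c y x * f_left c (V - {y}) y)"
      by algebra
  qed
  also have "\<dots> = f_fun c x v * (f_left c V v - 1) - g_fun c x v * (f_left c V x - 1)"
    using insert by (simp add: sum_subtractf sum_distrib_left[symmetric])
  finally have "1 + (\<Sum>y\<in>insert x V. g_fun c y v * f_left c (insert x V - {y}) y)
    = 1 + g_fun c x v + f_fun c x v * (f_left c V v - 1)"
    by (simp add: algebra_simps)
  moreover have "f_fun c x v = 1 + g_fun c x v"
    using insert by (intro f_fun_eq_g_fun) auto
  ultimately show ?case
    using insert by (simp add: algebra_simps)
qed simp

text \<open>The difference cancels the pole of \<open>g_fun c v w\<close> at \<open>v = w\<close>.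
  Both products are expanded in partial fractions, and the Arnold relation is applied to each
  summand.\<close>

lemma f_left_difference:
  assumes "finite V" "v \<notin> V" "w \<notin> V" "v \<noteq> w"
  shows "g_fun c v w * (f_left c V v - f_left c V w) = (\<Sum>y\<in>V. g_fun c y v * g_fun c y w * f_left c (V - {y}) y)"
proof -
  have "g_fun c v w * (g_fun c y v - g_fun c y w) = g_fun c y v * g_fun c y w" if "y \<in> V" for y
    using g_fun_mult_g_fun[of y v w c] that assms by (auto simp: algebra_simps)
  then have "g_fun c v w * (g_fun c y v * f_left c (V - {y}) y - g_fun c y w * f_left c (V - {y}) y)
      = g_fun c y v * g_fun c y w * f_left c (V - {y}) y" if "y \<in> V" for y
    using that by (metis left_diff_distrib mult.assoc)
  then show ?thesis
    unfolding f_left_partial_fractions[OF assms(1,2)] f_left_partial_fractions[OF assms(1,3)]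
    by (simp add: sum_distrib_left sum_subtractf[symmetric] cong: sum.cong)
qed

section \<open>Sums over the splittings of \<open>V\<close>\<close>

definition f_prod :: "complex \<Rightarrow> complex set \<Rightarrow> complex set \<Rightarrow> complex" where
  "f_prod c A B = (\<Prod>a\<in>A. \<Prod>b\<in>B. f_fun c a b)"

lemma f_prod_empty [simp]: "f_prod c {} B = 1" "f_prod c A {} = 1"
  by (simp_all add: f_prod_def)

lemma f_prod_insert:
  "finite A \<Longrightarrow> a \<notin> A \<Longrightarrow> f_prod c (insert a A) B = f_right c a B * f_prod c A B"
  "finite B \<Longrightarrow> b \<notin> B \<Longrightarrow> f_prod c A (insert b B) = f_left c A b * f_prod c A B"
  by (simp_all add: f_prod_def prod.distrib)

lemma f_prod_uminus [simp]: "f_prod (- c) A B = f_prod c B A"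
  unfolding f_prod_def by (simp add: prod.swap[of _ B A])

lemma sum_Pow_Diff:
  "(\<Sum>W\<in>Pow V. F (V - W)) = (\<Sum>W\<in>Pow V. F W)"
  by (rule sum.reindex_bij_witness[where i = "\<lambda>W. V - W" and j = "\<lambda>W. V - W"]) (auto simp: double_diff)

text \<open>For fixed \<open>A\<close> and \<open>B\<close>, this is the sum over
  \<open>V\<^sub>1 = W\<close> that remains once the Bethe equations have turned f(V1,V2) into the
  weight of the splitting.\<close>

definition dwpf_convolution :: "complex \<Rightarrow> complex set \<Rightarrow> complex set \<Rightarrow> complex set \<Rightarrow> complex" where
  "dwpf_convolution c V A B = (\<Sum>W\<in>Pow V. f_prod c W (V - W) * dwpf c (V - W) A * dwpf (- c) W B)"

text \<open>
  The second sum collects the terms in which \<open>f(W,v)\<close> does not simply turn into \<open>f(W,w)\<close>. It is,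
  up to the sign, symmetric under \<open>c \<mapsto> -c\<close>, hence cancels in \<open>dwpf_convolution_insert\<close>.
\<close>

lemma dwpf_convolution_step:
  fixes Y :: "complex set \<Rightarrow> complex"
  assumes "finite V" "finite A" "v \<notin> V" "insert v V \<inter> A = {}"
  shows "(\<Sum>W\<in>Pow V. f_prod c W (V - W) * f_left c W v * dwpf c (insert v (V - W)) A * Y W)
    = (\<Sum>w\<in>A. g_fun c v w * f_left c V w * f_right c w (A - {w})
          * (\<Sum>W\<in>Pow V. f_prod c W (V - W) * dwpf c (V - W) (A - {w}) * Y W))
      + (\<Sum>y\<in>V. \<Sum>W\<in>Pow (V - {y}). g_fun c y v * f_left c W y * f_right c y (V - {y} - W)
          * f_prod c W (V - {y} - W) * dwpf c (insert y (V - {y} - W)) A * Y (insert y W))"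
    (is "?L = ?R1 + ?R2")
proof -
  let ?k = "\<lambda>W w. f_left c (V - W) w * f_right c w (A - {w}) * dwpf c (V - W) (A - {w})"
  have rec: "dwpf c (insert y (V - W)) A = (\<Sum>w\<in>A. g_fun c y w * ?k W w)"
    if "W \<subseteq> V" "y = v \<or> y \<in> W" for W y
    using that assms by (subst dwpf_insert) (auto simp: mult_ac)
  have "?R1 = (\<Sum>W\<in>Pow V. \<Sum>w\<in>A. f_prod c W (V - W) * Y W * (f_left c W w * g_fun c v w) * ?k W w)"
    unfolding sum_distrib_left
  proof (subst sum.swap, intro sum.cong refl)
    fix W w assume "W \<in> Pow V"
    then have "f_left c V w = f_left c W w * f_left c (V - W) w"
      using assms by (subst prod.subset_diff[of W V]) (auto simp: mult_ac)
    then show "g_fun c v w * f_left c V w * f_right c w (A - {w}) *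
       (f_prod c W (V - W) * dwpf c (V - W) (A - {w}) * Y W)
       = f_prod c W (V - W) * Y W * (f_left c W w * g_fun c v w) * ?k W w"
      by simp
  qed
  moreover have "?L = (\<Sum>W\<in>Pow V. \<Sum>w\<in>A. f_prod c W (V - W) * Y W * (f_left c W v * g_fun c v w) * ?k W w)"
    by (intro sum.cong refl) (simp add: rec sum_distrib_left sum_distrib_right mult_ac)
  ultimately have "?L - ?R1 = (\<Sum>W\<in>Pow V. \<Sum>w\<in>A. f_prod c W (V - W) * Y W
      * (g_fun c v w * (f_left c W v - f_left c W w)) * ?k W w)"
    by (simp add: sum_subtractf[symmetric] algebra_simps)
  also have "\<dots> = (\<Sum>W\<in>Pow V. \<Sum>w\<in>A. \<Sum>y\<in>W. f_prod c W (V - W) * Y W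
      * (g_fun c y v * g_fun c y w * f_left c (W - {y}) y) * ?k W w)"
    unfolding sum_distrib_left[symmetric] sum_distrib_right[symmetric]
    using assms by (intro sum.cong refl arg_cong2[where f = "(*)"] f_left_difference)
      (auto intro: finite_subset)
  \<comment> \<open>The factor \<open>g_fun c y w\<close> produced by
    \<open>f_left_difference\<close> is the one with which \<open>dwpf_insert\<close> pairs
    \<open>y\<close>. Hence the sum over \<open>w\<close> closes to a partition function containing
    \<open>y\<close>, while \<open>Y W\<close> still contains \<open>y\<close> as well.\<close>
  also have "\<dots> = (\<Sum>W\<in>Pow V. \<Sum>y\<in>W. f_prod c W (V - W) * Y W
      * g_fun c y v * f_left c (W - {y}) y * dwpf c (insert y (V - W)) A)"
  proof (rule sum.cong[OF refl], subst sum.swap, rule sum.cong[OF refl])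
    fix W y assume "W \<in> Pow V" "y \<in> W"
    then show "(\<Sum>w\<in>A. f_prod c W (V - W) * Y W * (g_fun c y v * g_fun c y w * f_left c (W - {y}) y) * ?k W w)
      = f_prod c W (V - W) * Y W * g_fun c y v * f_left c (W - {y}) y * dwpf c (insert y (V - W)) A"
      by (simp add: rec sum_distrib_left mult_ac)
  qed
  also have "\<dots> = ?R2"
    unfolding sum_Pow_member[OF assms(1)]
  proof (intro sum.cong refl)
    fix y W assume y: "y \<in> V" and W: "W \<in> Pow (V - {y})"
    define U where "U = V - {y} - W"
    have "V - insert y W = U" "insert y W - {y} = W" "finite W" "y \<notin> W"
      using W assms by (auto simp: U_def intro: finite_subset)
    then show "f_prod c (insert y W) (V - insert y W) * Y (insert y W) * g_fun c y v *
       f_left c (insert y W - {y}) y * dwpf c (insert y (V - insert y W)) A =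
       g_fun c y v * f_left c W y * f_right c y (V - {y} - W) * f_prod c W (V - {y} - W) *
       dwpf c (insert y (V - {y} - W)) A * Y (insert y W)"
      unfolding U_def[symmetric] by (simp add: f_prod_insert)
  qed
  finally show ?thesis by (simp only: diff_eq_eq add.commute)
qed

text \<open>The new element \<open>v\<close> joins either \<open>V - W\<close> or \<open>W\<close>.
  The second case is the first one with \<open>W\<close> replaced by its complement and
  \<open>c\<close> by \<open>- c\<close>, so \<open>dwpf_convolution_step\<close> treats both. The
  two remainders are opposite to each other, which is the cancellation of poles inside
  \<open>V\<close>.\<close>

lemma dwpf_convolution_insert:
  assumes "finite V" "finite A" "finite B" "v \<notin> V" "insert v V \<inter> (A \<union> B) = {}"
  shows "dwpf_convolution c (insert v V) A B =
    (\<Sum>w\<in>A. g_fun c v w * f_left c V w * f_right c w (A - {w}) * dwpf_convolution c V (A - {w}) B)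
    - (\<Sum>w\<in>B. g_fun c v w * f_right c w V * f_left c (B - {w}) w * dwpf_convolution c V A (B - {w}))"
proof -
  have flip: "(\<Sum>W\<in>Pow V. f_prod c W (V - W) * dwpf c (V - W) X * dwpf (- c) W Y)
    = (\<Sum>W\<in>Pow V. f_prod (- c) W (V - W) * dwpf (- c) (V - W) Y * dwpf c W X)" for X Y
    by (subst sum_Pow_Diff[symmetric], intro sum.cong refl) (auto simp: double_diff)
  have "dwpf_convolution c (insert v V) A B =
    (\<Sum>W\<in>Pow V. f_prod c W (V - W) * f_left c W v * dwpf c (insert v (V - W)) A * dwpf (- c) W B)
    + (\<Sum>W\<in>Pow V. f_prod c W (V - W) * f_right c v (V - W) * dwpf c (V - W) A * dwpf (- c) (insert v W) B)"
    unfolding dwpf_convolution_def sum_Pow_insert[OF assms(1,4)] sum.distrib[symmetric]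
  proof (intro sum.cong refl)
    fix W assume W: "W \<in> Pow V"
    have "insert v V - W = insert v (V - W)" "insert v V - insert v W = V - W" "finite W" "v \<notin> W"
      using W assms by (auto intro: finite_subset)
    then show "f_prod c W (insert v V - W) * dwpf c (insert v V - W) A * dwpf (- c) W B
      + f_prod c (insert v W) (insert v V - insert v W) * dwpf c (insert v V - insert v W) A * dwpf (- c) (insert v W) B
      = f_prod c W (V - W) * f_left c W v * dwpf c (insert v (V - W)) A * dwpf (- c) W B
      + f_prod c W (V - W) * f_right c v (V - W) * dwpf c (V - W) A * dwpf (- c) (insert v W) B"
      using assms by (simp add: f_prod_insert)
  qed
  also have "(\<Sum>W\<in>Pow V. f_prod c W (V - W) * f_right c v (V - W) * dwpf c (V - W) A * dwpf (- c) (insert v W) B)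
    = (\<Sum>W\<in>Pow V. f_prod (- c) W (V - W) * f_left (- c) W v * dwpf (- c) (insert v (V - W)) B * dwpf c W A)"
    by (subst sum_Pow_Diff[symmetric], intro sum.cong refl) (auto simp: double_diff)
  also have "\<dots> = - (\<Sum>w\<in>B. g_fun c v w * f_right c w V * f_left c (B - {w}) w * dwpf_convolution c V A (B - {w}))
      + (\<Sum>y\<in>V. \<Sum>W\<in>Pow (V - {y}). - (g_fun c y v * f_right c y W * f_left c (V - {y} - W) y
          * f_prod c (V - {y} - W) W * dwpf (- c) (insert y (V - {y} - W)) B * dwpf c (insert y W) A))"
    using assms unfolding dwpf_convolution_def flip
    by (subst dwpf_convolution_step) (auto simp: sum_negf)
  \<comment> \<open>Taking complements inside \<open>V - {y}\<close> turns this remainder into the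
    negative of the one from the other case.\<close>
  also have "(\<Sum>y\<in>V. \<Sum>W\<in>Pow (V - {y}). - (g_fun c y v * f_right c y W * f_left c (V - {y} - W) y
          * f_prod c (V - {y} - W) W * dwpf (- c) (insert y (V - {y} - W)) B * dwpf c (insert y W) A))
    = - (\<Sum>y\<in>V. \<Sum>W\<in>Pow (V - {y}). g_fun c y v * f_left c W y * f_right c y (V - {y} - W)
          * f_prod c W (V - {y} - W) * dwpf c (insert y (V - {y} - W)) A * dwpf (- c) (insert y W) B)"
    unfolding sum_negf
    by (subst sum_Pow_Diff[symmetric], intro sum.cong refl arg_cong[where f = uminus])
      (auto simp: double_diff mult_ac)
  also have "(\<Sum>W\<in>Pow V. f_prod c W (V - W) * f_left c W v * dwpf c (insert v (V - W)) A * dwpf (- c) W B)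
    = (\<Sum>w\<in>A. g_fun c v w * f_left c V w * f_right c w (A - {w}) * dwpf_convolution c V (A - {w}) B)
      + (\<Sum>y\<in>V. \<Sum>W\<in>Pow (V - {y}). g_fun c y v * f_left c W y * f_right c y (V - {y} - W)
          * f_prod c W (V - {y} - W) * dwpf c (insert y (V - {y} - W)) A * dwpf (- c) (insert y W) B)"
    using assms unfolding dwpf_convolution_def by (subst dwpf_convolution_step) auto
  finally show ?thesis by simp
qed


section \<open>The coefficient of the multiple action\<close>

text \<open>On shell this is the scalar product without its factor \<lambda>2(V). The functions
  \<open>l\<^sub>1\<close> and \<open>l\<^sub>2\<close> are arguments, since each recursion step
  multiplies them by factors f.\<close>

definition dwpf_expansion ::
    "complex \<Rightarrow> (complex \<Rightarrow> complex) \<Rightarrow> (complex \<Rightarrow> complex) \<Rightarrow> complex set \<Rightarrow> complex set \<Rightarrow> complex" where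
  "dwpf_expansion c l\<^sub>1 l\<^sub>2 V U = (\<Sum>A\<in>Pow U. (\<Prod>a\<in>A. l\<^sub>1 a) * (\<Prod>b\<in>U - A. l\<^sub>2 b) * f_prod c (U - A) A
      * dwpf_convolution c V A (U - A))"

text \<open>The element \<open>w\<close> paired with \<open>v\<close> leaves either \<open>A\<close>
  or its complement B. In both cases one of f(w,A), f(B,w) comes from \<open>f_prod\<close> and the
  other from \<open>dwpf_convolution_insert\<close>. The same two products thus appear each time and
  are absorbed in \<open>l\<^sub>1\<close> and \<open>l\<^sub>2\<close>.\<close>

lemma dwpf_expansion_insert:
  assumes "finite V" "finite U" "v \<notin> V" "insert v V \<inter> U = {}"
  shows "dwpf_expansion c l\<^sub>1 l\<^sub>2 (insert v V) U =
    (\<Sum>w\<in>U. g_fun c v w * (l\<^sub>1 w * f_left c V w - l\<^sub>2 w * f_right c w V)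
      * dwpf_expansion c (\<lambda>a. l\<^sub>1 a * f_fun c w a) (\<lambda>b. l\<^sub>2 b * f_fun c b w) V (U - {w}))"
proof -
  define X where "X A = (\<Prod>a\<in>A. l\<^sub>1 a) * (\<Prod>b\<in>U - A. l\<^sub>2 b) * f_prod c (U - A) A" for A
  define E where "E w A = (\<Prod>a\<in>A. l\<^sub>1 a * f_fun c w a) * (\<Prod>b\<in>U - {w} - A. l\<^sub>2 b * f_fun c b w)
      * f_prod c (U - {w} - A) A * dwpf_convolution c V A (U - {w} - A)" for w A
  have member: "X (insert w A) * (g_fun c v w * f_left c V w * f_right c w (insert w A - {w})
      * dwpf_convolution c V (insert w A - {w}) (U - insert w A))
      = g_fun c v w * (l\<^sub>1 w * f_left c V w) * E w A"
    if "w \<in> U" "A \<in> Pow (U - {w})" for w A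
  proof -
    have "insert w A - {w} = A" "U - insert w A = U - {w} - A" "finite A" "w \<notin> A" "finite (U - {w} - A)"
      using that assms by (auto intro: finite_subset)
    then show ?thesis
      by (simp add: X_def E_def f_prod_insert prod.distrib)
  qed
  have nonmember: "X A * (g_fun c v w * f_right c w V * f_left c (U - A - {w}) w
      * dwpf_convolution c V A (U - A - {w}))
      = g_fun c v w * (l\<^sub>2 w * f_right c w V) * E w A"
    if "w \<in> U" "A \<in> Pow (U - {w})" for w A
  proof -
    define B where "B = U - {w} - A"
    have "U - A = insert w B" "U - {w} - A = B" "finite A" "w \<notin> B" "finite B" "insert w B - {w} = B"
      using that assms by (auto simp: B_def intro: finite_subset)
    then show ?thesis
      by (simp add: X_def E_def f_prod_insert prod.distrib)
  qed
  have "dwpf_expansion c l\<^sub>1 l\<^sub>2 (insert v V) U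
    = (\<Sum>A\<in>Pow U. \<Sum>w\<in>A. X A * (g_fun c v w * f_left c V w * f_right c w (A - {w})
        * dwpf_convolution c V (A - {w}) (U - A)))
    - (\<Sum>A\<in>Pow U. \<Sum>w\<in>U - A. X A * (g_fun c v w * f_right c w V * f_left c (U - A - {w}) w
        * dwpf_convolution c V A (U - A - {w})))"
    unfolding dwpf_expansion_def sum_subtractf[symmetric] sum_distrib_left[symmetric] right_diff_distrib[symmetric]
      X_def[symmetric]
    using assms by (intro sum.cong refl, subst dwpf_convolution_insert) (auto intro: finite_subset)
  also have "\<dots> = (\<Sum>w\<in>U. \<Sum>A\<in>Pow (U - {w}). g_fun c v w * (l\<^sub>1 w * f_left c V w) * E w A)
    - (\<Sum>w\<in>U. \<Sum>A\<in>Pow (U - {w}). g_fun c v w * (l\<^sub>2 w * f_right c w V) * E w A)"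
    unfolding sum_Pow_member[OF assms(2)] sum_Pow_nonmember[OF assms(2)]
    by (intro arg_cong2[where f = "(-)"] sum.cong refl member nonmember)
  also have "\<dots> = (\<Sum>w\<in>U. g_fun c v w * (l\<^sub>1 w * f_left c V w - l\<^sub>2 w * f_right c w V) * (\<Sum>A\<in>Pow (U - {w}). E w A))"
    by (simp add: sum_subtractf[symmetric] sum_distrib_left algebra_simps)
  finally show ?thesis
    by (simp add: dwpf_expansion_def E_def)
qed

lemma dwpf_expansion_empty:
  assumes "finite U"
  shows "dwpf_expansion c l\<^sub>1 l\<^sub>2 {} U = (if U = {} then 1 else 0)"
proof -
  have "dwpf_convolution c {} A (U - A) = 0" if "U \<noteq> {}" "A \<subseteq> U" for A
    using that assms by (auto simp: dwpf_convolution_def dwpf_empty finite_subset)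
  then have "U \<noteq> {} \<Longrightarrow> dwpf_expansion c l\<^sub>1 l\<^sub>2 {} U = 0"
    unfolding dwpf_expansion_def by (intro sum.neutral) auto
  moreover have "dwpf_expansion c l\<^sub>1 l\<^sub>2 {} {} = 1"
    by (simp add: dwpf_expansion_def dwpf_convolution_def dwpf_empty)
  ultimately show ?thesis by auto
qed

text \<open>The form of the recursion that matches \<open>exchange_coeff\<close>: products over
  \<open>U - {w}\<close> stand in the coefficient, and \<open>v\<close> modifies the functions. As
  for \<open>dwpf_insert'\<close>, one removes \<open>y\<close> by the other recursion,
  \<open>v\<close> by induction, and exchanges the two sums.\<close>

lemma dwpf_expansion_insert':
  assumes "finite V" "finite U" "v \<notin> V" "insert v V \<inter> U = {}"
  shows "dwpf_expansion c l\<^sub>1 l\<^sub>2 (insert v V) U =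
    (\<Sum>w\<in>U. g_fun c v w * (l\<^sub>1 w * f_left c (U - {w}) w - l\<^sub>2 w * f_right c w (U - {w}))
      * dwpf_expansion c (\<lambda>a. l\<^sub>1 a * f_fun c v a) (\<lambda>b. l\<^sub>2 b * f_fun c b v) V (U - {w}))"
  using assms
proof (induction V arbitrary: U l\<^sub>1 l\<^sub>2 rule: finite_induct)
  case empty
  \<comment> \<open>With \<open>V = {}\<close> the expansion is 1 or 0 according to whether
    \<open>X\<close> is empty, whatever the functions are. It thus forces all products over
    \<open>X\<close> to be 1.\<close>
  have "(l\<^sub>1 w * f_left c {} w - l\<^sub>2 w * f_right c w {}) * dwpf_expansion c m\<^sub>1 m\<^sub>2 {} X
    = (l\<^sub>1 w * f_left c X w - l\<^sub>2 w * f_right c w X) * dwpf_expansion c m\<^sub>1' m\<^sub>2' {} X"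
    if "finite X" for w X m\<^sub>1 m\<^sub>2 m\<^sub>1' m\<^sub>2'
    using that by (cases "X = {}") (simp_all add: dwpf_expansion_empty)
  with empty show ?case
    by (subst dwpf_expansion_insert) (auto simp: mult.assoc intro!: sum.cong)
next
  case (insert y V)
  define E where "E w w' = dwpf_expansion c (\<lambda>a. l\<^sub>1 a * f_fun c v a * f_fun c w' a)
    (\<lambda>b. l\<^sub>2 b * f_fun c b v * f_fun c b w') V (U - {w} - {w'})" for w w'
  define M where "M w = g_fun c v w * (l\<^sub>1 w * f_left c (U - {w}) w - l\<^sub>2 w * f_right c w (U - {w}))" for w
  define N where "N w' = g_fun c y w' * (l\<^sub>1 w' * f_fun c v w' * f_left c V w' - l\<^sub>2 w' * f_fun c w' v * f_right c w' V)" for w'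
  have "dwpf_expansion c l\<^sub>1 l\<^sub>2 (insert v (insert y V)) U = dwpf_expansion c l\<^sub>1 l\<^sub>2 (insert y (insert v V)) U"
    by (simp add: insert_commute)
  also have "\<dots> = (\<Sum>w'\<in>U. g_fun c y w' * (l\<^sub>1 w' * f_left c (insert v V) w' - l\<^sub>2 w' * f_right c w' (insert v V))
      * dwpf_expansion c (\<lambda>a. l\<^sub>1 a * f_fun c w' a) (\<lambda>b. l\<^sub>2 b * f_fun c b w') (insert v V) (U - {w'}))"
    using insert by (subst dwpf_expansion_insert) auto
  also have "\<dots> = (\<Sum>w'\<in>U. \<Sum>w\<in>U - {w'}. M w * (N w' * E w w'))"
  proof (intro sum.cong refl)
    fix w' assume w': "w' \<in> U"
    have "dwpf_expansion c (\<lambda>a. l\<^sub>1 a * f_fun c w' a) (\<lambda>b. l\<^sub>2 b * f_fun c b w') (insert v V) (U - {w'})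
      = (\<Sum>w\<in>U - {w'}. g_fun c v w * (l\<^sub>1 w * f_fun c w' w * f_left c (U - {w'} - {w}) w
          - l\<^sub>2 w * f_fun c w w' * f_right c w (U - {w'} - {w}))
        * dwpf_expansion c (\<lambda>a. l\<^sub>1 a * f_fun c w' a * f_fun c v a) (\<lambda>b. l\<^sub>2 b * f_fun c b w' * f_fun c b v) V (U - {w'} - {w}))"
      using insert w' by (intro insert.IH) auto
    also have "\<dots> = (\<Sum>w\<in>U - {w'}. M w * E w w')"
    proof (intro sum.cong refl)
      fix w assume w: "w \<in> U - {w'}"
      have "f_left c (U - {w}) w = f_fun c w' w * f_left c (U - {w} - {w'}) w"
        "f_right c w (U - {w}) = f_fun c w w' * f_right c w (U - {w} - {w'})"
        using w w' insert.prems by (auto intro!: prod.remove)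
      moreover have "U - {w'} - {w} = U - {w} - {w'}"
        by auto
      ultimately show "g_fun c v w * (l\<^sub>1 w * f_fun c w' w * f_left c (U - {w'} - {w}) w
          - l\<^sub>2 w * f_fun c w w' * f_right c w (U - {w'} - {w}))
        * dwpf_expansion c (\<lambda>a. l\<^sub>1 a * f_fun c w' a * f_fun c v a) (\<lambda>b. l\<^sub>2 b * f_fun c b w' * f_fun c b v) V (U - {w'} - {w})
        = M w * E w w'"
        by (simp add: M_def E_def mult_ac)
    qed
    finally have IH: "dwpf_expansion c (\<lambda>a. l\<^sub>1 a * f_fun c w' a) (\<lambda>b. l\<^sub>2 b * f_fun c b w') (insert v V) (U - {w'})
      = (\<Sum>w\<in>U - {w'}. M w * E w w')" .
    have "g_fun c y w' * (l\<^sub>1 w' * f_left c (insert v V) w' - l\<^sub>2 w' * f_right c w' (insert v V)) = N w'"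
      using insert by (simp add: N_def mult.assoc)
    with IH show "g_fun c y w' * (l\<^sub>1 w' * f_left c (insert v V) w' - l\<^sub>2 w' * f_right c w' (insert v V))
      * dwpf_expansion c (\<lambda>a. l\<^sub>1 a * f_fun c w' a) (\<lambda>b. l\<^sub>2 b * f_fun c b w') (insert v V) (U - {w'})
      = (\<Sum>w\<in>U - {w'}. M w * (N w' * E w w'))"
      by (simp only: sum_distrib_left mult.left_commute)
  qed
  also have "\<dots> = (\<Sum>w\<in>U. M w * (\<Sum>w'\<in>U - {w}. N w' * E w w'))"
    unfolding sum_distrib_left using insert.prems by (intro sum_swap_distinct) auto
  also have "\<dots> = (\<Sum>w\<in>U. M w
      * dwpf_expansion c (\<lambda>a. l\<^sub>1 a * f_fun c v a) (\<lambda>b. l\<^sub>2 b * f_fun c b v) (insert y V) (U - {w}))"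
    using insert by (intro sum.cong refl, subst dwpf_expansion_insert) (auto simp: N_def E_def)
  finally show ?case
    by (simp add: M_def)
qed

text \<open>One action adds at most one element to the current set, so the number of elements of
  \<open>S'\<close> still missing drops by at most one.\<close>

lemma iterated_coeff_eq_0:
  assumes "finite S'" "length zs < card (S' - S)"
  shows "iterated_coeff c lam zs S S' = 0"
  using assms(2)
proof (induction zs arbitrary: S)
  case (Cons z zs)
  have "length zs < card (S' - insert z (S - {w}))" for w
  proof -
    have "card (S' - S) \<le> card (insert z (S' - insert z (S - {w})))"
      using assms(1) by (intro card_mono) auto
    also have "\<dots> \<le> Suc (card (S' - insert z (S - {w})))"
      by (rule card_insert_le_m1) auto
    finally show ?thesis
      using Cons.prems by simp
  qed
  then show ?case
    using Cons by simp
qed auto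

text \<open>Here \<open>P\<close> holds the parameters already brought in by earlier actions and
  \<open>U\<close> what is left of the initial set. Products over \<open>P\<close> in the exchange
  coefficients become the modification of \<lambda>1 and \<lambda>2, and an exchange of
  \<open>w\<close> in \<open>U\<close> for \<open>z\<close> is one step of
  \<open>dwpf_expansion_insert'\<close>. All other terms vanish by counting.\<close>

lemma iterated_coeff_eq_dwpf_expansion:
  assumes "finite P" "finite U" "distinct zs" "P \<inter> U = {}" "set zs \<inter> (P \<union> U) = {}"
  shows "iterated_coeff c lam zs (P \<union> U) (P \<union> set zs) =
    dwpf_expansion c (\<lambda>u. lam 1 u * f_left c P u) (\<lambda>u. lam 2 u * f_right c u P) (set zs) U"
  using assms
proof (induction zs arbitrary: P U)
  case Nil
  then have "P = P \<union> U \<longleftrightarrow> U = {}"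
    by auto
  with Nil show ?case
    by (simp add: dwpf_expansion_empty)
next
  case (Cons z zs)
  let ?S' = "P \<union> set (z # zs)"
  have fin: "finite (P \<union> U)" and disj: "z \<notin> P" "z \<notin> U" "P \<inter> U = {}"
    using Cons.prems by auto
  have tau: "iterated_coeff c lam zs (P \<union> U) ?S' = 0"
  proof (rule iterated_coeff_eq_0)
    have "?S' - (P \<union> U) = set (z # zs)"
      using Cons.prems by auto
    then show "length zs < card (?S' - (P \<union> U))"
      using Cons.prems by (simp add: distinct_card)
  qed (use Cons.prems in auto)
  \<comment> \<open>An exchange that gives up \<open>w\<close> in \<open>P\<close> leaves
    \<open>w\<close> and all of \<open>zs\<close> missing, one element more than the remaining
    actions can supply.\<close>
  have old: "iterated_coeff c lam zs (insert z (P \<union> U - {w})) ?S' = 0" if "w \<in> P" for w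
  proof (rule iterated_coeff_eq_0)
    have "length zs < card (insert w (set zs))"
      using Cons.prems that by (subst card_insert_disjoint) (auto simp: distinct_card)
    also have "\<dots> \<le> card (?S' - insert z (P \<union> U - {w}))"
      using Cons.prems that by (intro card_mono) auto
    finally show "length zs < card (?S' - insert z (P \<union> U - {w}))" .
  qed (use Cons.prems in auto)
  have new: "exchange_coeff c lam z (P \<union> U) w * iterated_coeff c lam zs (insert z (P \<union> U - {w})) ?S'
    = g_fun c z w * (lam 1 w * f_left c P w * f_left c (U - {w}) w - lam 2 w * f_right c w P * f_right c w (U - {w}))
      * dwpf_expansion c (\<lambda>a. lam 1 a * f_left c P a * f_fun c z a) (\<lambda>b. lam 2 b * f_right c b P * f_fun c b z) (set zs) (U - {w})"
    if "w \<in> U" for w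
  proof -
    have eqs: "insert z (P \<union> U - {w}) = insert z P \<union> (U - {w})" "?S' = insert z P \<union> set zs" "P \<union> U - {w} = P \<union> (U - {w})"
      using that disj by auto
    have "iterated_coeff c lam zs (insert z (P \<union> U - {w})) ?S' =
      dwpf_expansion c (\<lambda>u. lam 1 u * f_left c (insert z P) u) (\<lambda>u. lam 2 u * f_right c u (insert z P)) (set zs) (U - {w})"
      unfolding eqs(1,2) using Cons.prems by (intro Cons.IH) auto
    moreover have "(\<Prod>x\<in>P \<union> (U - {w}). h x) = (\<Prod>x\<in>P. h x) * (\<Prod>x\<in>U - {w}. h x)" for h :: "complex \<Rightarrow> complex"
      using Cons.prems by (intro prod.union_disjoint) auto
    ultimately show ?thesis
      unfolding exchange_coeff_def eqs(3) using Cons.prems by (simp add: mult_ac)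
  qed
  have "iterated_coeff c lam (z # zs) (P \<union> U) ?S'
    = (\<Sum>w\<in>P \<union> U. exchange_coeff c lam z (P \<union> U) w * iterated_coeff c lam zs (insert z (P \<union> U - {w})) ?S')"
    using tau by simp
  also have "\<dots> = (\<Sum>w\<in>U. exchange_coeff c lam z (P \<union> U) w * iterated_coeff c lam zs (insert z (P \<union> U - {w})) ?S')"
    using fin old by (intro sum.mono_neutral_right) auto
  also have "\<dots> = dwpf_expansion c (\<lambda>u. lam 1 u * f_left c P u) (\<lambda>u. lam 2 u * f_right c u P) (set (z # zs)) U"
  proof -
    have "dwpf_expansion c (\<lambda>u. lam 1 u * f_left c P u) (\<lambda>u. lam 2 u * f_right c u P) (insert z (set zs)) U
      = (\<Sum>w\<in>U. g_fun c z w * (lam 1 w * f_left c P w * f_left c (U - {w}) w - lam 2 w * f_right c w P * f_right c w (U - {w}))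
      * dwpf_expansion c (\<lambda>a. lam 1 a * f_left c P a * f_fun c z a) (\<lambda>b. lam 2 b * f_right c b P * f_fun c b z) (set zs) (U - {w}))"
      using Cons.prems by (intro dwpf_expansion_insert') auto
    with new show ?thesis by simp
  qed
  finally show ?case .
qed


section \<open>Korepin's expansion\<close>

text \<open>The inner sum of Korepin's expansion for a fixed splitting of \<open>V\<close>;
  \<open>W\<^sub>1\<close> and \<open>W\<^sub>2\<close> are the sets \<open>V\<^sub>1\<close> and
  \<open>V\<^sub>2\<close> of the outline.\<close>

definition dwpf_pair_expansion ::
    "complex \<Rightarrow> (complex \<Rightarrow> complex) \<Rightarrow> (complex \<Rightarrow> complex) \<Rightarrow> complex set \<Rightarrow> complex set \<Rightarrow> complex set \<Rightarrow> complex" where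
  "dwpf_pair_expansion c l\<^sub>1 l\<^sub>2 W\<^sub>1 W\<^sub>2 S = (\<Sum>A\<in>Pow S. (\<Prod>a\<in>A. l\<^sub>1 a) * (\<Prod>b\<in>S - A. l\<^sub>2 b) * f_prod c (S - A) A
      * dwpf c W\<^sub>2 A * dwpf (- c) W\<^sub>1 (S - A))"

lemma dwpf_pair_expansion_flip:
  "dwpf_pair_expansion (- c) l\<^sub>2 l\<^sub>1 W\<^sub>2 W\<^sub>1 S = dwpf_pair_expansion c l\<^sub>1 l\<^sub>2 W\<^sub>1 W\<^sub>2 S"
  unfolding dwpf_pair_expansion_def
  by (subst sum_Pow_Diff[symmetric], intro sum.cong refl) (auto simp: double_diff mult_ac)

text \<open>
  The terms of the expansion over \<open>insert v R\<close> in which \<open>v\<close> carries \<open>\<lambda>\<^sub>2\<close>.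
\<close>

definition dwpf_pair_expansion_right ::
    "complex \<Rightarrow> (complex \<Rightarrow> complex) \<Rightarrow> (complex \<Rightarrow> complex) \<Rightarrow> complex set \<Rightarrow> complex set \<Rightarrow> complex \<Rightarrow> complex set \<Rightarrow> complex" where
  "dwpf_pair_expansion_right c l\<^sub>1 l\<^sub>2 W\<^sub>1 W\<^sub>2 v R = (\<Sum>A\<in>Pow R. (\<Prod>a\<in>A. l\<^sub>1 a) * (\<Prod>b\<in>insert v (R - A). l\<^sub>2 b)
      * f_prod c (insert v (R - A)) A * dwpf c W\<^sub>2 A * dwpf (- c) W\<^sub>1 (insert v (R - A)))"

lemma dwpf_pair_expansion_insert:
  assumes "finite R" "v \<notin> R"
  shows "dwpf_pair_expansion c l\<^sub>1 l\<^sub>2 W\<^sub>1 W\<^sub>2 (insert v R) =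
    dwpf_pair_expansion_right c l\<^sub>1 l\<^sub>2 W\<^sub>1 W\<^sub>2 v R + dwpf_pair_expansion_right (- c) l\<^sub>2 l\<^sub>1 W\<^sub>2 W\<^sub>1 v R"
proof -
  have "insert v R - A = insert v (R - A)" "insert v R - insert v A = R - A" if "A \<in> Pow R" for A
    using that assms by auto
  then have "dwpf_pair_expansion c l\<^sub>1 l\<^sub>2 W\<^sub>1 W\<^sub>2 (insert v R) = dwpf_pair_expansion_right c l\<^sub>1 l\<^sub>2 W\<^sub>1 W\<^sub>2 v R
    + (\<Sum>A\<in>Pow R. (\<Prod>a\<in>insert v A. l\<^sub>1 a) * (\<Prod>b\<in>R - A. l\<^sub>2 b) * f_prod c (R - A) (insert v A)
      * dwpf c W\<^sub>2 (insert v A) * dwpf (- c) W\<^sub>1 (R - A))"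
    unfolding dwpf_pair_expansion_def dwpf_pair_expansion_right_def sum_Pow_insert[OF assms] sum.distrib[symmetric]
    by (intro sum.cong refl) presburger
  also have "(\<Sum>A\<in>Pow R. (\<Prod>a\<in>insert v A. l\<^sub>1 a) * (\<Prod>b\<in>R - A. l\<^sub>2 b) * f_prod c (R - A) (insert v A)
      * dwpf c W\<^sub>2 (insert v A) * dwpf (- c) W\<^sub>1 (R - A)) = dwpf_pair_expansion_right (- c) l\<^sub>2 l\<^sub>1 W\<^sub>2 W\<^sub>1 v R"
    unfolding dwpf_pair_expansion_right_def
    by (subst sum_Pow_Diff[symmetric], intro sum.cong refl) (auto simp: double_diff mult_ac)
  finally show ?thesis .
qed

text \<open>\<open>dwpf_insert'\<close> pairs \<open>v\<close> with some \<open>w\<close> in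
  \<open>A\<close>. \<open>dwpf_exchange\<close>, taken at \<open>- c\<close>, rewrites f(v,W1)
  times the other partition function: either f(v,W1) becomes f(v,S-A), which gives the single sum,
  or \<open>v\<close> replaces some \<open>w'\<close> in \<open>S - A\<close>, which gives the
  double sum.\<close>

lemma dwpf_pair_expansion_step:
  assumes "finite W\<^sub>1" "finite W\<^sub>2" "finite S" "v \<notin> W\<^sub>1" "v \<notin> W\<^sub>2" "v \<notin> S" "(W\<^sub>1 \<union> W\<^sub>2) \<inter> S = {}"
  shows "l\<^sub>2 v * f_right c v W\<^sub>1 * dwpf_pair_expansion c l\<^sub>1 l\<^sub>2 W\<^sub>1 (insert v W\<^sub>2) S =
    (\<Sum>w\<in>S. g_fun c v w * l\<^sub>1 w * l\<^sub>2 v * f_left c (S - {w}) w * f_right c v (S - {w})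
        * dwpf_pair_expansion c l\<^sub>1 l\<^sub>2 W\<^sub>1 W\<^sub>2 (S - {w}))
    - (\<Sum>w\<in>S. \<Sum>w'\<in>S - {w}. g_fun c v w * g_fun c v w' * l\<^sub>1 w * l\<^sub>2 w' * f_fun c w' w
        * f_left c (S - {w} - {w'}) w * f_right c w' (S - {w} - {w'})
        * dwpf_pair_expansion_right c l\<^sub>1 l\<^sub>2 W\<^sub>1 W\<^sub>2 v (S - {w} - {w'}))"
proof -
  define X where "X A = (\<Prod>a\<in>A. l\<^sub>1 a) * (\<Prod>b\<in>S - A. l\<^sub>2 b) * f_prod c (S - A) A" for A
  define k where "k A w = g_fun c v w * f_left c (A - {w}) w * f_right c v (A - {w}) * dwpf c W\<^sub>2 (A - {w})" for A w
  define m where "m B w = g_fun c v w * f_right c w (B - {w}) * dwpf (- c) W\<^sub>1 (insert v (B - {w}))" for B w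
  have fin: "finite A" if "A \<subseteq> S" for A
    using that assms(3) by (rule finite_subset)
  have K: "dwpf c (insert v W\<^sub>2) A = (\<Sum>w\<in>A. k A w)" if "A \<subseteq> S" for A
    unfolding k_def using assms that fin by (intro dwpf_insert') auto
  have Km: "f_right c v W\<^sub>1 * dwpf (- c) W\<^sub>1 B = f_right c v B * dwpf (- c) W\<^sub>1 B - (\<Sum>w\<in>B. m B w)" if "B \<subseteq> S" for B
    using assms that fin dwpf_exchange[of W\<^sub>1 B v "- c"] unfolding m_def
    by (auto simp: algebra_simps sum_negf)
  have "l\<^sub>2 v * f_right c v W\<^sub>1 * dwpf_pair_expansion c l\<^sub>1 l\<^sub>2 W\<^sub>1 (insert v W\<^sub>2) S
    = (\<Sum>A\<in>Pow S. l\<^sub>2 v * X A * dwpf c (insert v W\<^sub>2) A * (f_right c v W\<^sub>1 * dwpf (- c) W\<^sub>1 (S - A)))"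
    by (simp add: dwpf_pair_expansion_def X_def sum_distrib_left mult_ac)
  also have "\<dots> = (\<Sum>A\<in>Pow S. \<Sum>w\<in>A. l\<^sub>2 v * X A * k A w * (f_right c v (S - A) * dwpf (- c) W\<^sub>1 (S - A)))
    - (\<Sum>A\<in>Pow S. \<Sum>w\<in>A. \<Sum>w'\<in>S - A. l\<^sub>2 v * X A * k A w * m (S - A) w')"
    unfolding sum_distrib_left[symmetric] sum_distrib_right[symmetric] sum_subtractf[symmetric]
    by (intro sum.cong refl) (simp add: K Km algebra_simps)
  also have "(\<Sum>A\<in>Pow S. \<Sum>w\<in>A. l\<^sub>2 v * X A * k A w * (f_right c v (S - A) * dwpf (- c) W\<^sub>1 (S - A)))
    = (\<Sum>w\<in>S. g_fun c v w * l\<^sub>1 w * l\<^sub>2 v * f_left c (S - {w}) w * f_right c v (S - {w})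
        * dwpf_pair_expansion c l\<^sub>1 l\<^sub>2 W\<^sub>1 W\<^sub>2 (S - {w}))"
    unfolding sum_Pow_member[OF assms(3)] dwpf_pair_expansion_def sum_distrib_left
  proof (intro sum.cong refl)
    fix w A assume w: "w \<in> S" and A: "A \<in> Pow (S - {w})"
    define B where "B = S - {w} - A"
    have "S - insert w A = B" "insert w A - {w} = A" "S - {w} = A \<union> B" "A \<inter> B = {}" "finite A" "finite B" "w \<notin> A" "A \<union> B - A = B"
      using w A assms fin[of A] by (auto simp: B_def)
    then show "l\<^sub>2 v * X (insert w A) * k (insert w A) w * (f_right c v (S - insert w A) * dwpf (- c) W\<^sub>1 (S - insert w A))
      = g_fun c v w * l\<^sub>1 w * l\<^sub>2 v * f_left c (S - {w}) w * f_right c v (S - {w})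
        * ((\<Prod>a\<in>A. l\<^sub>1 a) * (\<Prod>b\<in>S - {w} - A. l\<^sub>2 b) * f_prod c (S - {w} - A) A
          * dwpf c W\<^sub>2 A * dwpf (- c) W\<^sub>1 (S - {w} - A))"
      by (simp add: X_def k_def f_prod_insert prod.union_disjoint)
  qed
  also have "(\<Sum>A\<in>Pow S. \<Sum>w\<in>A. \<Sum>w'\<in>S - A. l\<^sub>2 v * X A * k A w * m (S - A) w')
    = (\<Sum>w\<in>S. \<Sum>A\<in>Pow (S - {w}). \<Sum>w'\<in>S - {w} - A. l\<^sub>2 v * X (insert w A) * k (insert w A) w * m (S - insert w A) w')"
    unfolding sum_Pow_member[OF assms(3)] Diff_insert2[symmetric] by (simp add: insert_commute)
  also have "\<dots> = (\<Sum>w\<in>S. \<Sum>w'\<in>S - {w}. \<Sum>A\<in>Pow (S - {w} - {w'}).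
      l\<^sub>2 v * X (insert w A) * k (insert w A) w * m (S - insert w A) w')"
    using assms(3) by (subst sum_Pow_nonmember) auto
  also have "\<dots> = (\<Sum>w\<in>S. \<Sum>w'\<in>S - {w}. g_fun c v w * g_fun c v w' * l\<^sub>1 w * l\<^sub>2 w' * f_fun c w' w
        * f_left c (S - {w} - {w'}) w * f_right c w' (S - {w} - {w'})
        * dwpf_pair_expansion_right c l\<^sub>1 l\<^sub>2 W\<^sub>1 W\<^sub>2 v (S - {w} - {w'}))"
    unfolding dwpf_pair_expansion_right_def sum_distrib_left
  proof (intro sum.cong refl)
    fix w w' A assume w: "w \<in> S" "w' \<in> S - {w}" and A: "A \<in> Pow (S - {w} - {w'})"
    define B where "B = S - {w} - {w'} - A"
    have "S - insert w A = insert w' B" "insert w A - {w} = A" "insert w' B - {w'} = B" "S - {w} - {w'} = A \<union> B"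
      "A \<inter> B = {}" "finite A" "finite B" "w \<notin> A" "w' \<notin> B" "A \<union> B - A = B" "v \<notin> B"
      using w A assms fin[of A] by (auto simp: B_def)
    then show "l\<^sub>2 v * X (insert w A) * k (insert w A) w * m (S - insert w A) w'
      = g_fun c v w * g_fun c v w' * l\<^sub>1 w * l\<^sub>2 w' * f_fun c w' w
        * f_left c (S - {w} - {w'}) w * f_right c w' (S - {w} - {w'})
        * ((\<Prod>a\<in>A. l\<^sub>1 a) * (\<Prod>b\<in>insert v (S - {w} - {w'} - A). l\<^sub>2 b)
          * f_prod c (insert v (S - {w} - {w'} - A)) A * dwpf c W\<^sub>2 A * dwpf (- c) W\<^sub>1 (insert v (S - {w} - {w'} - A)))"
      by (simp add: X_def k_def m_def f_prod_insert prod.union_disjoint)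
  qed
  finally show ?thesis .
qed

text \<open>This and \<open>double_removal_coeff\<close> are the coefficients in the action of
  \<open>T 2 1 v\<close> on a Bethe vector, see \<open>T21_action\<close>. They already occur here
  because Korepin's sum obeys the same recursion.\<close>

definition removal_coeff ::
    "complex \<Rightarrow> (complex \<Rightarrow> complex) \<Rightarrow> (complex \<Rightarrow> complex) \<Rightarrow> complex \<Rightarrow> complex set \<Rightarrow> complex \<Rightarrow> complex" where
  "removal_coeff c l\<^sub>1 l\<^sub>2 v S w = g_fun c v w * (l\<^sub>1 w * l\<^sub>2 v * f_left c (S - {w}) w * f_right c v (S - {w})
      - l\<^sub>1 v * l\<^sub>2 w * f_right c w (S - {w}) * f_left c (S - {w}) v)"

definition double_removal_coeff ::
    "complex \<Rightarrow> (complex \<Rightarrow> complex) \<Rightarrow> (complex \<Rightarrow> complex) \<Rightarrow> complex \<Rightarrow> complex set \<Rightarrow> complex \<Rightarrow> complex \<Rightarrow> complex" where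
  "double_removal_coeff c l\<^sub>1 l\<^sub>2 v R w w' = - (g_fun c v w * g_fun c v w' * l\<^sub>1 w * l\<^sub>2 w' * f_fun c w' w
      * f_left c R w * f_right c w' R)"

text \<open>The two terms on the left are related by the symmetry
  \<open>dwpf_pair_expansion_flip\<close>, so \<open>dwpf_pair_expansion_step\<close> evaluates
  both. In the double sums, \<open>v\<close> carries \<open>l\<^sub>2\<close> in one and
  \<open>l\<^sub>1\<close> in the other; together they form the expansion over
  \<open>insert v (S - {w} - {w'})\<close>.\<close>

lemma dwpf_pair_expansion_recursion:
  assumes "finite W\<^sub>1" "finite W\<^sub>2" "finite S" "v \<notin> W\<^sub>1" "v \<notin> W\<^sub>2" "v \<notin> S" "(W\<^sub>1 \<union> W\<^sub>2) \<inter> S = {}"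
  shows "l\<^sub>2 v * f_right c v W\<^sub>1 * dwpf_pair_expansion c l\<^sub>1 l\<^sub>2 W\<^sub>1 (insert v W\<^sub>2) S
      + l\<^sub>1 v * f_left c W\<^sub>2 v * dwpf_pair_expansion c l\<^sub>1 l\<^sub>2 (insert v W\<^sub>1) W\<^sub>2 S
    = (\<Sum>w\<in>S. removal_coeff c l\<^sub>1 l\<^sub>2 v S w * dwpf_pair_expansion c l\<^sub>1 l\<^sub>2 W\<^sub>1 W\<^sub>2 (S - {w}))
    + (\<Sum>w\<in>S. \<Sum>w'\<in>S - {w}. double_removal_coeff c l\<^sub>1 l\<^sub>2 v (S - {w} - {w'}) w w'
        * dwpf_pair_expansion c l\<^sub>1 l\<^sub>2 W\<^sub>1 W\<^sub>2 (insert v (S - {w} - {w'})))"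
proof -
  let ?D = "double_removal_coeff c l\<^sub>1 l\<^sub>2 v"
  let ?R = "dwpf_pair_expansion_right c l\<^sub>1 l\<^sub>2 W\<^sub>1 W\<^sub>2 v" and ?L = "dwpf_pair_expansion_right (- c) l\<^sub>2 l\<^sub>1 W\<^sub>2 W\<^sub>1 v"
  have 1: "l\<^sub>2 v * f_right c v W\<^sub>1 * dwpf_pair_expansion c l\<^sub>1 l\<^sub>2 W\<^sub>1 (insert v W\<^sub>2) S =
    (\<Sum>w\<in>S. g_fun c v w * l\<^sub>1 w * l\<^sub>2 v * f_left c (S - {w}) w * f_right c v (S - {w})
        * dwpf_pair_expansion c l\<^sub>1 l\<^sub>2 W\<^sub>1 W\<^sub>2 (S - {w}))
    + (\<Sum>w\<in>S. \<Sum>w'\<in>S - {w}. ?D (S - {w} - {w'}) w w' * ?R (S - {w} - {w'}))"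
    using dwpf_pair_expansion_step[of W\<^sub>1 W\<^sub>2 S v l\<^sub>2 c l\<^sub>1] assms by (simp add: double_removal_coeff_def sum_negf)
  have "l\<^sub>1 v * f_left c W\<^sub>2 v * dwpf_pair_expansion c l\<^sub>1 l\<^sub>2 (insert v W\<^sub>1) W\<^sub>2 S =
    l\<^sub>1 v * f_right (- c) v W\<^sub>2 * dwpf_pair_expansion (- c) l\<^sub>2 l\<^sub>1 W\<^sub>2 (insert v W\<^sub>1) S"
    by (simp add: dwpf_pair_expansion_flip)
  also have "\<dots> = - (\<Sum>w\<in>S. g_fun c v w * l\<^sub>2 w * l\<^sub>1 v * f_right c w (S - {w}) * f_left c (S - {w}) v
        * dwpf_pair_expansion c l\<^sub>1 l\<^sub>2 W\<^sub>1 W\<^sub>2 (S - {w}))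
    + (\<Sum>w\<in>S. \<Sum>w'\<in>S - {w}. ?D (S - {w} - {w'}) w' w * ?L (S - {w} - {w'}))"
    using assms by (subst dwpf_pair_expansion_step)
      (auto simp: double_removal_coeff_def sum_negf dwpf_pair_expansion_flip mult_ac)
  \<comment> \<open>The flip has interchanged the roles of \<open>w\<close> and \<open>w'\<close>;
    the set left over is symmetric in them, so renaming restores the order.\<close>
  also have "(\<Sum>w\<in>S. \<Sum>w'\<in>S - {w}. ?D (S - {w} - {w'}) w' w * ?L (S - {w} - {w'}))
    = (\<Sum>w\<in>S. \<Sum>w'\<in>S - {w}. ?D (S - {w} - {w'}) w w' * ?L (S - {w} - {w'}))"
    using assms(3) by (subst sum_swap_distinct) (simp_all add: Diff_insert2[symmetric] insert_commute)
  also note 2 = calculation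
  have "(\<Sum>w\<in>S. \<Sum>w'\<in>S - {w}. ?D (S - {w} - {w'}) w w'
        * dwpf_pair_expansion c l\<^sub>1 l\<^sub>2 W\<^sub>1 W\<^sub>2 (insert v (S - {w} - {w'})))
    = (\<Sum>w\<in>S. \<Sum>w'\<in>S - {w}. ?D (S - {w} - {w'}) w w' * ?R (S - {w} - {w'}))
    + (\<Sum>w\<in>S. \<Sum>w'\<in>S - {w}. ?D (S - {w} - {w'}) w w' * ?L (S - {w} - {w'}))"
    using assms by (simp add: dwpf_pair_expansion_insert distrib_left sum.distrib)
  moreover have "(\<Sum>w\<in>S. removal_coeff c l\<^sub>1 l\<^sub>2 v S w * dwpf_pair_expansion c l\<^sub>1 l\<^sub>2 W\<^sub>1 W\<^sub>2 (S - {w}))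
    = (\<Sum>w\<in>S. g_fun c v w * l\<^sub>1 w * l\<^sub>2 v * f_left c (S - {w}) w * f_right c v (S - {w})
        * dwpf_pair_expansion c l\<^sub>1 l\<^sub>2 W\<^sub>1 W\<^sub>2 (S - {w}))
    - (\<Sum>w\<in>S. g_fun c v w * l\<^sub>2 w * l\<^sub>1 v * f_right c w (S - {w}) * f_left c (S - {w}) v
        * dwpf_pair_expansion c l\<^sub>1 l\<^sub>2 W\<^sub>1 W\<^sub>2 (S - {w}))"
    by (simp add: removal_coeff_def sum_subtractf[symmetric] algebra_simps)
  ultimately show ?thesis
    unfolding 1 2 by simp
qed

definition korepin_sum ::
    "complex \<Rightarrow> (complex \<Rightarrow> complex) \<Rightarrow> (complex \<Rightarrow> complex) \<Rightarrow> complex set \<Rightarrow> complex set \<Rightarrow> complex" where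
  "korepin_sum c l\<^sub>1 l\<^sub>2 V S = (\<Sum>W\<in>Pow V. (\<Prod>v\<in>W. l\<^sub>1 v) * (\<Prod>v\<in>V - W. l\<^sub>2 v) * f_prod c (V - W) W
      * dwpf_pair_expansion c l\<^sub>1 l\<^sub>2 W (V - W) S)"

text \<open>Putting \<open>v\<close> into \<open>V - W\<close> or into \<open>W\<close> multiplies
  the weight of the splitting by precisely the factors of the two terms in
  \<open>dwpf_pair_expansion_recursion\<close>, whose right side has coefficients independent of
  \<open>W\<close>.\<close>

lemma korepin_sum_insert:
  assumes "finite V" "finite S" "v \<notin> V" "insert v V \<inter> S = {}"
  shows "korepin_sum c l\<^sub>1 l\<^sub>2 (insert v V) S =
      (\<Sum>w\<in>S. removal_coeff c l\<^sub>1 l\<^sub>2 v S w * korepin_sum c l\<^sub>1 l\<^sub>2 V (S - {w}))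
    + (\<Sum>w\<in>S. \<Sum>w'\<in>S - {w}. double_removal_coeff c l\<^sub>1 l\<^sub>2 v (S - {w} - {w'}) w w'
        * korepin_sum c l\<^sub>1 l\<^sub>2 V (insert v (S - {w} - {w'})))"
proof -
  define X where "X W = (\<Prod>v\<in>W. l\<^sub>1 v) * (\<Prod>v\<in>V - W. l\<^sub>2 v) * f_prod c (V - W) W" for W
  define P where "P = dwpf_pair_expansion c l\<^sub>1 l\<^sub>2"
  have "korepin_sum c l\<^sub>1 l\<^sub>2 (insert v V) S = (\<Sum>W\<in>Pow V. X W *
    (l\<^sub>2 v * f_right c v W * P W (insert v (V - W)) S + l\<^sub>1 v * f_left c (V - W) v * P (insert v W) (V - W) S))"
    unfolding korepin_sum_def sum_Pow_insert[OF assms(1,3)]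
  proof (intro sum.cong refl)
    fix W assume W: "W \<in> Pow V"
    have "insert v V - W = insert v (V - W)" "insert v V - insert v W = V - W" "finite W" "v \<notin> W"
      using W assms by (auto intro: finite_subset)
    then show "(\<Prod>v\<in>W. l\<^sub>1 v) * (\<Prod>v\<in>insert v V - W. l\<^sub>2 v) * f_prod c (insert v V - W) W
        * dwpf_pair_expansion c l\<^sub>1 l\<^sub>2 W (insert v V - W) S
      + (\<Prod>v\<in>insert v W. l\<^sub>1 v) * (\<Prod>v\<in>insert v V - insert v W. l\<^sub>2 v) * f_prod c (insert v V - insert v W) (insert v W)
        * dwpf_pair_expansion c l\<^sub>1 l\<^sub>2 (insert v W) (insert v V - insert v W) S
      = X W * (l\<^sub>2 v * f_right c v W * P W (insert v (V - W)) S + l\<^sub>1 v * f_left c (V - W) v * P (insert v W) (V - W) S)"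
      using assms by (simp add: X_def P_def f_prod_insert algebra_simps)
  qed
  also have "\<dots> = (\<Sum>W\<in>Pow V. X W * ((\<Sum>w\<in>S. removal_coeff c l\<^sub>1 l\<^sub>2 v S w * P W (V - W) (S - {w}))
    + (\<Sum>w\<in>S. \<Sum>w'\<in>S - {w}. double_removal_coeff c l\<^sub>1 l\<^sub>2 v (S - {w} - {w'}) w w'
        * P W (V - W) (insert v (S - {w} - {w'})))))"
    unfolding P_def using assms
    by (intro sum.cong refl arg_cong2[where f = "(*)"] dwpf_pair_expansion_recursion) (auto intro: finite_subset)
  also have "\<dots> = (\<Sum>w\<in>S. removal_coeff c l\<^sub>1 l\<^sub>2 v S w * korepin_sum c l\<^sub>1 l\<^sub>2 V (S - {w}))
    + (\<Sum>w\<in>S. \<Sum>w'\<in>S - {w}. double_removal_coeff c l\<^sub>1 l\<^sub>2 v (S - {w} - {w'}) w w'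
        * korepin_sum c l\<^sub>1 l\<^sub>2 V (insert v (S - {w} - {w'})))"
    by (simp add: korepin_sum_def X_def[symmetric] P_def[symmetric] distrib_left sum.distrib sum_distrib_left
        sum.swap[of _ _ "Pow V"] mult.left_commute)
  finally show ?thesis .
qed

lemma korepin_sum_empty:
  assumes "finite S"
  shows "korepin_sum c l\<^sub>1 l\<^sub>2 {} S = (if S = {} then 1 else 0)"
proof -
  have "dwpf c {} A * dwpf (- c) {} (S - A) = 0" if "S \<noteq> {}" "A \<subseteq> S" for A
    using that assms by (auto simp: dwpf_empty finite_subset)
  then have "S \<noteq> {} \<Longrightarrow> korepin_sum c l\<^sub>1 l\<^sub>2 {} S = 0"
    unfolding korepin_sum_def dwpf_pair_expansion_def by (auto intro!: sum.neutral)
  moreover have "korepin_sum c l\<^sub>1 l\<^sub>2 {} {} = 1"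
    by (simp add: korepin_sum_def dwpf_pair_expansion_def dwpf_empty)
  ultimately show ?thesis by auto
qed

section \<open>Korepin's sum under the Bethe equations\<close>

lemma prod_swap_distinct:
  fixes F :: "'a \<Rightarrow> 'a \<Rightarrow> 'b::comm_monoid_mult"
  assumes "finite A"
  shows "(\<Prod>x\<in>A. \<Prod>y\<in>A - {x}. F x y) = (\<Prod>y\<in>A. \<Prod>x\<in>A - {y}. F x y)"
proof -
  have "(\<Prod>x\<in>A. \<Prod>y\<in>A - {x}. F x y) = (\<Prod>(x, y)\<in>Sigma A (\<lambda>x. A - {x}). F x y)"
    using assms by (subst prod.Sigma) auto
  also have "\<dots> = (\<Prod>(y, x)\<in>Sigma A (\<lambda>y. A - {y}). F x y)"
    by (rule prod.reindex_bij_witness[where i = prod.swap and j = prod.swap]) auto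
  also have "\<dots> = (\<Prod>y\<in>A. \<Prod>x\<in>A - {y}. F x y)"
    using assms by (subst prod.Sigma) auto
  finally show ?thesis .
qed

text \<open>Multiply the Bethe equations over all elements of \<open>W\<close>. The factors f
  between two elements of \<open>W\<close> form the same product \<open>N\<close> on both sides, and
  \<open>N\<close> is nonzero, so only the factors between \<open>W\<close> and \<open>V - W\<close>
  remain.\<close>

lemma korepin_sum_on_shell:
  assumes "finite V"
    and nz: "\<And>v w. v \<in> V \<Longrightarrow> w \<in> V - {v} \<Longrightarrow> f_fun c w v \<noteq> 0"
    and bethe: "\<And>v. v \<in> V \<Longrightarrow> l\<^sub>1 v * f_left c (V - {v}) v = l\<^sub>2 v * f_right c v (V - {v})"
  shows "korepin_sum c l\<^sub>1 l\<^sub>2 V S = (\<Prod>v\<in>V. l\<^sub>2 v) * dwpf_expansion c l\<^sub>1 l\<^sub>2 V S"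
proof -
  have coeff: "(\<Prod>v\<in>W. l\<^sub>1 v) * (\<Prod>v\<in>V - W. l\<^sub>2 v) * f_prod c (V - W) W = (\<Prod>v\<in>V. l\<^sub>2 v) * f_prod c W (V - W)"
    if W: "W \<in> Pow V" for W
  proof -
    have fin: "finite W"
      using W assms(1) by (auto intro: finite_subset)
    define N where "N = (\<Prod>w\<in>W. f_left c (W - {w}) w)"
    have N': "(\<Prod>w\<in>W. f_right c w (W - {w})) = N"
      unfolding N_def using fin by (subst prod_swap_distinct) auto
    have "N \<noteq> 0"
      unfolding N_def using fin W nz by (auto simp: subset_iff)
    have split: "(\<Prod>x\<in>V - {w}. h x) = (\<Prod>x\<in>V - W. h x) * (\<Prod>x\<in>W - {w}. h x)" if "w \<in> W" for w and h :: "complex \<Rightarrow> complex"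
    proof -
      have "V - {w} = (V - W) \<union> (W - {w})"
        using that W by auto
      then show ?thesis
        using assms(1) fin by (auto intro!: prod.union_disjoint)
    qed
    have "(\<Prod>w\<in>W. l\<^sub>1 w * f_left c (V - {w}) w) = (\<Prod>w\<in>W. l\<^sub>2 w * f_right c w (V - {w}))"
      using bethe W by (intro prod.cong) auto
    then have "(\<Prod>w\<in>W. l\<^sub>1 w) * f_prod c (V - W) W * N = (\<Prod>w\<in>W. l\<^sub>2 w) * f_prod c W (V - W) * N"
      by (simp add: split prod.distrib N' N_def[symmetric] f_prod_def prod.swap[of _ W] mult_ac cong: prod.cong)
    then have "(\<Prod>w\<in>W. l\<^sub>1 w) * f_prod c (V - W) W = (\<Prod>w\<in>W. l\<^sub>2 w) * f_prod c W (V - W)"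
      using \<open>N \<noteq> 0\<close> by simp
    moreover have "(\<Prod>v\<in>V. l\<^sub>2 v) = (\<Prod>v\<in>V - W. l\<^sub>2 v) * (\<Prod>v\<in>W. l\<^sub>2 v)"
      using W assms(1) by (intro prod.subset_diff) auto
    ultimately show ?thesis
      by (simp add: mult_ac)
  qed
  have "korepin_sum c l\<^sub>1 l\<^sub>2 V S = (\<Sum>W\<in>Pow V. (\<Prod>v\<in>V. l\<^sub>2 v) * f_prod c W (V - W)
      * dwpf_pair_expansion c l\<^sub>1 l\<^sub>2 W (V - W) S)"
    unfolding korepin_sum_def using coeff by (intro sum.cong refl) simp
  also have "\<dots> = (\<Prod>v\<in>V. l\<^sub>2 v) * dwpf_expansion c l\<^sub>1 l\<^sub>2 V S"
    unfolding dwpf_expansion_def dwpf_pair_expansion_def dwpf_convolution_def sum_distrib_left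
    by (subst sum.swap) (simp add: mult_ac)
  finally show ?thesis .
qed


section \<open>Action of the monodromy matrix on Bethe vectors\<close>

lemma op_prod_empty [simp]: "op_prod A {} x = x"
  by (simp add: op_prod_def)

lemma op_prod_insert:
  assumes "\<And>u v x. A u (A v x) = A v (A u x)" "finite S" "z \<notin> S"
  shows "op_prod A (insert z S) x = A z (op_prod A S x)"
    and "op_prod A (insert z S) x = op_prod A S (A z x)"
proof -
  interpret comp_fun_commute A
    using assms(1) by unfold_locales (auto simp: fun_eq_iff)
  show "op_prod A (insert z S) x = A z (op_prod A S x)"
    using assms by (simp add: op_prod_def)
  show "op_prod A (insert z S) x = op_prod A S (A z x)"
    using assms unfolding op_prod_def by (intro fold_insert2) auto
qed

lemma sum_UNIV_22: "(\<Sum>e\<in>UNIV. F e) = F (1, 1) + F (1, 2) + F (2, 1) + F (2, 2)"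
  for F :: "2 \<times> 2 \<Rightarrow> 'b::comm_monoid_add"
proof -
  have "(UNIV :: (2 \<times> 2) set) = {(1, 1), (1, 2), (2, 1), (2, 2)}"
    using exhaust_2 by (auto simp: set_eq_iff)
  then have "(\<Sum>e\<in>UNIV. F e) = (\<Sum>e\<in>{(1, 1), (1, 2), (2, 1), (2, 2)}. F e)"
    by (rule arg_cong)
  also have "\<dots> = F (1, 1) + F (1, 2) + F (2, 1) + F (2, 2)"
    by (simp add: add.assoc)
  finally show ?thesis .
qed

context generalized_model
begin

section \<open>Commutation relations of the monodromy entries\<close>

lemma T_hom: "module_hom cscale cscale (T i j u)"
  using T_linear by (rule Vector_Spaces.linear.axioms(3))

lemmas T_add = module_hom.add[OF T_hom]
  and T_scale = module_hom.scale[OF T_hom]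
  and T_zero = module_hom.zero[OF T_hom]
  and T_neg = module_hom.neg[OF T_hom]
  and T_sum = module_hom.sum[OF T_hom]

lemma RTT_commutator:
  assumes "u \<noteq> v"
  shows "T i j u (T k l v x) + cscale (g_fun c u v) (T k j u (T i l v x))
    = T k l v (T i j u x) + cscale (g_fun c u v) (T k j v (T i l u x))"
proof -
  have "i = 1 \<or> i = 2" "j = 1 \<or> j = 2" "k = 1 \<or> k = 2" "l = 1 \<or> l = 2"
    by (rule exhaust_2)+
  \<comment> \<open>The first tensor factor carries the indices \<open>i\<close>, \<open>j\<close>
    and the second \<open>k\<close>, \<open>l\<close>, so the relation is the entry in row
    \<open>(i, k)\<close> and column \<open>(j, l)\<close>.\<close>
  with RTT[OF assms, THEN fun_cong, of "(i, k)", THEN fun_cong, of "(j, l)", THEN fun_cong, of x]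
  show ?thesis
    unfolding block_mult_def sum_UNIV_22
    by (elim disjE) (simp_all add: scalar_block_def R_matrix_def permutation_matrix_def
        first_factor_def second_factor_def T_zero T_add T_scale scale_left_distrib add_ac)
qed

lemma T_commute: "T i j u (T i j v x) = T i j v (T i j u x)"
proof (cases "u = v")
  case False
  let ?a = "T i j u (T i j v x)" and ?b = "T i j v (T i j u x)"
  have "cscale (1 + g_fun c u v) ?a = cscale (1 + g_fun c u v) ?b"
    using RTT_commutator[OF False, of i j i j x] by (simp add: scale_left_distrib)
  moreover have "cscale (1 - g_fun c u v) ?b = cscale (1 - g_fun c u v) ?a"
    using RTT_commutator[of v u i j i j x] False by (simp add: scale_left_diff_distrib g_fun_swap[of c v u])
  \<comment> \<open>At u - v = -c the first relation is empty because 1 + g vanishes; the relation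
    with \<open>u\<close> and \<open>v\<close> interchanged then has the factor 1 - g = 2.\<close>
  moreover have "1 + g_fun c u v \<noteq> 0 \<or> 1 - g_fun c u v \<noteq> 0"
    by (auto simp: add_eq_0_iff)
  ultimately show ?thesis
    by (auto simp: scale_cancel_left)
qed simp

text \<open>The commutator of T11(u) with T22(v) and that of T11(v) with T22(u) both equal g(u,v)
  times the same difference of products of T21 and T12.\<close>

lemma transfer_matrix_commute:
  "transfer_matrix T u (transfer_matrix T v x) = transfer_matrix T v (transfer_matrix T u x)"
proof (cases "u = v")
  case False
  have "T 1 1 u (T 2 2 v x) + cscale (g_fun c u v) (T 2 1 u (T 1 2 v x))
    = T 2 2 v (T 1 1 u x) + cscale (g_fun c u v) (T 2 1 v (T 1 2 u x))"
    using False by (rule RTT_commutator)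
  moreover have "T 1 1 v (T 2 2 u x) - cscale (g_fun c u v) (T 2 1 v (T 1 2 u x))
    = T 2 2 u (T 1 1 v x) - cscale (g_fun c u v) (T 2 1 u (T 1 2 v x))"
    using RTT_commutator[of v u 1 1 2 2 x] False by (simp add: g_fun_swap[of c v u])
  ultimately have "T 1 1 u (T 2 2 v x) + T 2 2 u (T 1 1 v x) = T 1 1 v (T 2 2 u x) + T 2 2 v (T 1 1 u x)"
    by (simp add: eq_diff_eq[symmetric] diff_eq_eq)
  then show ?thesis
    by (simp add: transfer_matrix_def T_add T_commute[of _ _ u v] algebra_simps)
qed simp

lemma T11_T12:
  assumes "u \<noteq> z"
  shows "T 1 1 z (T 1 2 u x) = cscale (f_fun c u z) (T 1 2 u (T 1 1 z x)) + cscale (g_fun c z u) (T 1 2 z (T 1 1 u x))"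
  using RTT_commutator[OF assms, of 1 2 1 1 x] assms
  by (simp add: f_fun_eq_g_fun g_fun_swap[of c z u] scale_left_distrib algebra_simps)

lemma T22_T12:
  assumes "u \<noteq> z"
  shows "T 2 2 z (T 1 2 u x) = cscale (f_fun c z u) (T 1 2 u (T 2 2 z x)) - cscale (g_fun c z u) (T 1 2 z (T 2 2 u x))"
  using RTT_commutator[of z u 2 2 1 2 x] assms
  by (simp add: f_fun_eq_g_fun scale_left_distrib algebra_simps)

lemma T21_T12:
  assumes "u \<noteq> v"
  shows "T 2 1 v (T 1 2 u x) = T 1 2 u (T 2 1 v x)
    + (cscale (g_fun c v u) (T 1 1 u (T 2 2 v x)) - cscale (g_fun c v u) (T 1 1 v (T 2 2 u x)))"
  using RTT_commutator[of v u 2 1 1 2 x] assms by (simp add: algebra_simps)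

section \<open>Diagonal entries and the transfer matrix on Bethe vectors\<close>

abbreviation bethe :: "complex set \<Rightarrow> 'h" where
  "bethe \<equiv> bethe_vector T vac"

lemma bethe_empty: "bethe {} = vac"
  by (simp add: bethe_vector_def)

lemma bethe_insert: "finite S \<Longrightarrow> u \<notin> S \<Longrightarrow> bethe (insert u S) = T 1 2 u (bethe S)"
  unfolding bethe_vector_def by (intro op_prod_insert T_commute)

text \<open>Stated for an abstract family \<open>A\<close> so that it covers \<open>T 1 1\<close>
  with \<open>d = c\<close> and \<open>T 2 2\<close> with \<open>d = - c\<close>.\<close>

lemma diagonal_action:
  assumes hom: "\<And>z. module_hom cscale cscale (A z)"
    and A_T12: "\<And>z u x. u \<noteq> z \<Longrightarrow> A z (T 1 2 u x) =
      cscale (f_fun d u z) (T 1 2 u (A z x)) + cscale (g_fun d z u) (T 1 2 z (A u x))"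
    and A_vac: "\<And>z. A z vac = cscale (l z) vac"
    and "finite S" "z \<notin> S"
  shows "A z (bethe S) = cscale (l z * f_left d S z) (bethe S)
    + (\<Sum>w\<in>S. cscale (g_fun d z w * l w * f_left d (S - {w}) w) (bethe (insert z (S - {w}))))"
  using assms(4,5)
proof (induction S arbitrary: z rule: finite_induct)
  case empty
  then show ?case by (simp add: bethe_empty A_vac)
next
  case (insert u S)
  have u: "u \<noteq> z" "u \<notin> S" "z \<notin> S"
    using insert by auto
  have bu: "T 1 2 u (bethe (insert z (S - {w}))) = bethe (insert z (insert u S - {w}))"
    and bz: "T 1 2 z (bethe (insert u (S - {w}))) = bethe (insert z (insert u S - {w}))" if "w \<in> S" for w
  proof -
    have "insert u S - {w} = insert u (S - {w})"
      using that u by auto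
    then show "T 1 2 u (bethe (insert z (S - {w}))) = bethe (insert z (insert u S - {w}))"
      "T 1 2 z (bethe (insert u (S - {w}))) = bethe (insert z (insert u S - {w}))"
      using insert u by (auto simp: bethe_insert[symmetric] insert_commute)
  qed
  \<comment> \<open>Two paths lead to the exchange of \<open>w\<close> for \<open>z\<close>:
    \<open>A z\<close> passes \<open>u\<close> and then replaces \<open>w\<close>, or
    \<open>u\<close> is first exchanged for \<open>z\<close> and \<open>A u\<close> then replaces
    \<open>w\<close> by \<open>u\<close>. \<open>exchange_identity\<close> adds them up.\<close>
  have coeff: "f_fun d u z * (g_fun d z w * l w * f_left d (S - {w}) w) + g_fun d z u * (g_fun d u w * l w * f_left d (S - {w}) w)
    = g_fun d z w * l w * f_left d (insert u S - {w}) w" if "w \<in> S" for w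
  proof -
    have "insert u S - {w} = insert u (S - {w})" "z \<noteq> w" "u \<noteq> w"
      using that u by auto
    moreover from this have "f_fun d u z * g_fun d z w + g_fun d z u * g_fun d u w = g_fun d z w * f_fun d u w"
      using u by (intro exchange_identity) auto
    moreover have "f_left d (insert u (S - {w})) w = f_fun d u w * f_left d (S - {w}) w"
      using insert by simp
    ultimately show ?thesis
      by (simp add: distrib_right[symmetric] mult.assoc[symmetric])
  qed
  have "A z (bethe (insert u S)) = cscale (f_fun d u z) (T 1 2 u (A z (bethe S))) + cscale (g_fun d z u) (T 1 2 z (A u (bethe S)))"
    using insert u by (simp add: bethe_insert A_T12)
  also have "\<dots> = cscale (l z * f_left d (insert u S) z) (bethe (insert u S))
    + (cscale (g_fun d z u * l u * f_left d S u) (bethe (insert z S))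
    + (\<Sum>w\<in>S. cscale (f_fun d u z * (g_fun d z w * l w * f_left d (S - {w}) w)) (T 1 2 u (bethe (insert z (S - {w})))))
    + (\<Sum>w\<in>S. cscale (g_fun d z u * (g_fun d u w * l w * f_left d (S - {w}) w)) (T 1 2 z (bethe (insert u (S - {w}))))))"
    unfolding insert.IH[OF \<open>z \<notin> S\<close>] insert.IH[OF \<open>u \<notin> S\<close>] T_add T_scale T_sum
    using insert u by (simp add: bethe_insert scale_right_distrib scale_sum_right mult_ac add_ac)
  also have "\<dots> = cscale (l z * f_left d (insert u S) z) (bethe (insert u S))
    + (cscale (g_fun d z u * l u * f_left d S u) (bethe (insert z S))
    + (\<Sum>w\<in>S. cscale (g_fun d z w * l w * f_left d (insert u S - {w}) w) (bethe (insert z (insert u S - {w})))))"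
    unfolding add.assoc sum.distrib[symmetric]
    by (simp add: bu bz coeff[symmetric] scale_left_distrib cong: sum.cong)
  also have "\<dots> = cscale (l z * f_left d (insert u S) z) (bethe (insert u S))
    + (\<Sum>w\<in>insert u S. cscale (g_fun d z w * l w * f_left d (insert u S - {w}) w) (bethe (insert z (insert u S - {w}))))"
    using insert u by simp
  finally show ?case .
qed

lemma T11_action:
  assumes "finite S" "z \<notin> S"
  shows "T 1 1 z (bethe S) = cscale (lam 1 z * f_left c S z) (bethe S)
    + (\<Sum>w\<in>S. cscale (g_fun c z w * lam 1 w * f_left c (S - {w}) w) (bethe (insert z (S - {w}))))"
  using assms by (intro diagonal_action T_hom T11_T12 T_diag_vac)

lemma T22_action:
  assumes "finite S" "z \<notin> S"
  shows "T 2 2 z (bethe S) = cscale (lam 2 z * f_right c z S) (bethe S)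
    + (\<Sum>w\<in>S. cscale (- (g_fun c z w * lam 2 w * f_right c w (S - {w}))) (bethe (insert z (S - {w}))))"
  using diagonal_action[of "T 2 2" "- c" "lam 2", OF T_hom _ T_diag_vac assms] by (simp add: T22_T12)

lemma transfer_matrix_action:
  assumes "finite S" "z \<notin> S"
  shows "transfer_matrix T z (bethe S) = cscale (tau c lam z S) (bethe S)
    + (\<Sum>w\<in>S. cscale (exchange_coeff c lam z S w) (bethe (insert z (S - {w}))))"
  unfolding transfer_matrix_def T11_action[OF assms] T22_action[OF assms] tau_def exchange_coeff_def
  by (simp add: scale_left_distrib scale_right_diff_distrib scale_left_diff_distrib sum.distrib sum_subtractf sum_negf
      right_diff_distrib mult_ac)

lemma op_prod_hom:
  assumes "\<And>u v x. A u (A v x) = A v (A u x)" "\<And>u. module_hom cscale cscale (A u)" "finite S"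
  shows "module_hom cscale cscale (op_prod A S)"
  using assms(3)
proof (induction S rule: finite_induct)
  case empty
  then show ?case
    using module_axioms by (simp add: module_hom_iff op_prod_def)
next
  case (insert z S)
  have "op_prod A (insert z S) = A z \<circ> op_prod A S"
    using op_prod_insert(1)[of A S z, OF assms(1) insert.hyps] by (simp add: fun_eq_iff)
  then show ?case
    using module_hom_compose[OF insert.IH assms(2)[of z]] by (simp only:)
qed

lemma transfer_matrix_hom: "module_hom cscale cscale (transfer_matrix T u)"
proof -
  have "transfer_matrix T u = (\<lambda>x. T 1 1 u x + T 2 2 u x)"
    by (simp add: transfer_matrix_def fun_eq_iff)
  then show ?thesis
    using T_hom by (simp add: module_hom_iff scale_right_distrib add_ac)
qed

text \<open>The sum runs over all subsets of size \<open>n\<close> of a fixed \<open>W\<close>, not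
  only over those that can be reached from \<open>S\<close>. One index set then serves every step of
  the induction.\<close>

lemma multiple_action:
  assumes "distinct zs" "finite S" "set zs \<inter> S = {}" "finite W" "S \<union> set zs \<subseteq> W" "card S = n"
  shows "op_prod (transfer_matrix T) (set zs) (bethe S)
    = (\<Sum>S' | S' \<subseteq> W \<and> card S' = n. cscale (iterated_coeff c lam zs S S') (bethe S'))"
  using assms
proof (induction zs arbitrary: S)
  case Nil
  have "(\<Sum>S' | S' \<subseteq> W \<and> card S' = n. cscale (iterated_coeff c lam [] S S') (bethe S'))
    = (\<Sum>S'\<in>{S}. cscale (iterated_coeff c lam [] S S') (bethe S'))"
    using Nil by (intro sum.mono_neutral_right) auto
  then show ?case by simp
next
  case (Cons z zs)
  let ?N = "{S'. S' \<subseteq> W \<and> card S' = n}"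
  let ?P = "op_prod (transfer_matrix T) (set zs)"
  have z: "z \<notin> S" "z \<notin> set zs"
    using Cons.prems by auto
  interpret P: module_hom cscale cscale ?P
    by (intro op_prod_hom transfer_matrix_commute transfer_matrix_hom) simp
  have IH: "?P (bethe S) = (\<Sum>S'\<in>?N. cscale (iterated_coeff c lam zs S S') (bethe S'))"
    using Cons.prems by (intro Cons.IH) auto
  have IHw: "?P (bethe (insert z (S - {w})))
    = (\<Sum>S'\<in>?N. cscale (iterated_coeff c lam zs (insert z (S - {w})) S') (bethe S'))" if "w \<in> S" for w
    using Cons.prems that z card_Suc_Diff1[of S w] by (intro Cons.IH) auto
  have "op_prod (transfer_matrix T) (set (z # zs)) (bethe S) = ?P (transfer_matrix T z (bethe S))"
    using op_prod_insert(2)[of "transfer_matrix T" "set zs" z, OF transfer_matrix_commute] z by simp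
  also have "\<dots> = cscale (tau c lam z S) (?P (bethe S))
    + (\<Sum>w\<in>S. cscale (exchange_coeff c lam z S w) (?P (bethe (insert z (S - {w})))))"
    using Cons.prems z by (simp add: transfer_matrix_action P.add P.scale P.sum)
  also have "\<dots> = (\<Sum>S'\<in>?N. cscale (tau c lam z S * iterated_coeff c lam zs S S') (bethe S'))
    + (\<Sum>w\<in>S. \<Sum>S'\<in>?N. cscale (exchange_coeff c lam z S w * iterated_coeff c lam zs (insert z (S - {w})) S') (bethe S'))"
    by (simp add: IH IHw scale_sum_right)
  also have "\<dots> = (\<Sum>S'\<in>?N. cscale (iterated_coeff c lam (z # zs) S S') (bethe S'))"
    by (subst sum.swap) (simp add: sum.distrib[symmetric] scale_left_distrib scale_sum_left)
  finally show ?case .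
qed

section \<open>The action of \<open>T 2 1\<close> on Bethe vectors\<close>

lemma T11_T22_action:
  assumes "module_hom cscale (*) \<psi>" "finite S" "u \<notin> S" "v \<notin> S" "u \<noteq> v"
  shows "\<psi> (T 1 1 u (T 2 2 v (bethe S))) =
    lam 2 v * f_right c v S * lam 1 u * f_left c S u * \<psi> (bethe S)
    + (\<Sum>w\<in>S. (lam 2 v * f_right c v S * g_fun c u w * lam 1 w * f_left c (S - {w}) w
        - g_fun c v w * lam 2 w * f_right c w (S - {w}) * g_fun c u v * lam 1 v * f_left c (S - {w}) v)
        * \<psi> (bethe (insert u (S - {w}))))
    - (\<Sum>w\<in>S. g_fun c v w * lam 2 w * f_right c w (S - {w}) * lam 1 u * f_fun c v u * f_left c (S - {w}) u
        * \<psi> (bethe (insert v (S - {w}))))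
    - (\<Sum>w\<in>S. \<Sum>w'\<in>S - {w}. g_fun c v w' * lam 2 w' * f_right c w' (S - {w'}) * g_fun c u w * lam 1 w
        * f_fun c v w * f_left c (S - {w} - {w'}) w * \<psi> (bethe (insert u (insert v (S - {w} - {w'})))))"
proof -
  interpret \<psi>: module_hom cscale "(*)" \<psi> by (fact assms(1))
  note hom = \<psi>.neg \<psi>.add \<psi>.sum \<psi>.scale
  let ?b = "\<lambda>w. - (g_fun c v w * lam 2 w * f_right c w (S - {w}))"
  \<comment> \<open>After \<open>T 2 2 v\<close> has exchanged \<open>w'\<close> for
    \<open>v\<close>, the entry \<open>T 1 1 u\<close> may keep the set, exchange \<open>v\<close>
    itself, or exchange another element \<open>w\<close>; these are the three terms.\<close>
  have T11: "\<psi> (T 1 1 u (bethe (insert v (S - {w'})))) =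
      lam 1 u * f_fun c v u * f_left c (S - {w'}) u * \<psi> (bethe (insert v (S - {w'})))
      + g_fun c u v * lam 1 v * f_left c (S - {w'}) v * \<psi> (bethe (insert u (S - {w'})))
      + (\<Sum>w\<in>S - {w'}. g_fun c u w * lam 1 w * f_fun c v w * f_left c (S - {w} - {w'}) w
          * \<psi> (bethe (insert u (insert v (S - {w} - {w'})))))" for w'
  proof -
    have v: "v \<notin> S - {w'}" "insert v (S - {w'}) - {v} = S - {w'}"
      using assms by auto
    have "f_left c (insert v (S - {w'}) - {w}) w = f_fun c v w * f_left c (S - {w} - {w'}) w"
      "insert v (S - {w'}) - {w} = insert v (S - {w} - {w'})" if "w \<in> S - {w'}" for w
    proof -
      show *: "insert v (S - {w'}) - {w} = insert v (S - {w} - {w'})"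
        using that assms by auto
      show "f_left c (insert v (S - {w'}) - {w}) w = f_fun c v w * f_left c (S - {w} - {w'}) w"
        unfolding * using assms by simp
    qed
    then have "(\<Sum>w\<in>S - {w'}. g_fun c u w * lam 1 w * f_left c (insert v (S - {w'}) - {w}) w
        * \<psi> (bethe (insert u (insert v (S - {w'}) - {w}))))
      = (\<Sum>w\<in>S - {w'}. g_fun c u w * lam 1 w * f_fun c v w * f_left c (S - {w} - {w'}) w
          * \<psi> (bethe (insert u (insert v (S - {w} - {w'})))))"
      by (intro sum.cong refl) simp
    then show ?thesis
      using assms v by (subst T11_action) (simp_all add: hom mult.assoc)
  qed
  have "\<psi> (T 1 1 u (T 2 2 v (bethe S))) = lam 2 v * f_right c v S * \<psi> (T 1 1 u (bethe S))
    + (\<Sum>w'\<in>S. ?b w' * \<psi> (T 1 1 u (bethe (insert v (S - {w'})))))"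
    using assms by (simp add: T22_action T_neg T_add T_scale T_sum hom)
  also have "\<psi> (T 1 1 u (bethe S)) = lam 1 u * f_left c S u * \<psi> (bethe S)
    + (\<Sum>w\<in>S. g_fun c u w * lam 1 w * f_left c (S - {w}) w * \<psi> (bethe (insert u (S - {w}))))"
    using assms by (simp add: T11_action hom)
  also have "(\<Sum>w'\<in>S. ?b w' * \<psi> (T 1 1 u (bethe (insert v (S - {w'}))))) =
      (\<Sum>w'\<in>S. ?b w' * (lam 1 u * f_fun c v u * f_left c (S - {w'}) u * \<psi> (bethe (insert v (S - {w'})))))
      + (\<Sum>w'\<in>S. ?b w' * (g_fun c u v * lam 1 v * f_left c (S - {w'}) v * \<psi> (bethe (insert u (S - {w'})))))
      + (\<Sum>w'\<in>S. \<Sum>w\<in>S - {w'}. ?b w' * (g_fun c u w * lam 1 w * f_fun c v w * f_left c (S - {w} - {w'}) w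
          * \<psi> (bethe (insert u (insert v (S - {w} - {w'}))))))"
    unfolding T11 by (simp only: distrib_left sum.distrib sum_distrib_left)
  also have "(\<Sum>w'\<in>S. \<Sum>w\<in>S - {w'}. ?b w' * (g_fun c u w * lam 1 w * f_fun c v w * f_left c (S - {w} - {w'}) w
          * \<psi> (bethe (insert u (insert v (S - {w} - {w'}))))))
    = (\<Sum>w\<in>S. \<Sum>w'\<in>S - {w}. ?b w' * (g_fun c u w * lam 1 w * f_fun c v w * f_left c (S - {w} - {w'}) w
          * \<psi> (bethe (insert u (insert v (S - {w} - {w'}))))))"
    using assms(2) by (rule sum_swap_distinct)
  finally show ?thesis
    by (simp add: algebra_simps sum_distrib_left sum.distrib sum_subtractf sum_negf)
qed

text \<open>
  Composing with an arbitrary functional makes the induction a computation with complex numbers: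
  the operator \<open>T\<^sub>1\<^sub>2(u)\<close> in front is absorbed in \<open>\<psi>\<close>.
\<close>

lemma T21_action:
  assumes "module_hom cscale (*) \<psi>" "finite S" "v \<notin> S"
  shows "\<psi> (T 2 1 v (bethe S)) =
    (\<Sum>w\<in>S. removal_coeff c (lam 1) (lam 2) v S w * \<psi> (bethe (S - {w})))
    + (\<Sum>w\<in>S. \<Sum>w'\<in>S - {w}. double_removal_coeff c (lam 1) (lam 2) v (S - {w} - {w'}) w w'
        * \<psi> (bethe (insert v (S - {w} - {w'}))))"
  using assms(2,1,3)
proof (induction S arbitrary: \<psi> rule: finite_induct)
  case empty
  then show ?case
    by (simp add: bethe_empty T21_vac module_hom.zero)
next
  case (insert u S)
  interpret \<psi>: module_hom cscale "(*)" \<psi> by (fact insert.prems(1))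
  have u: "u \<noteq> v" "u \<notin> S" "v \<notin> S"
    using insert by auto
  let ?A = "removal_coeff c (lam 1) (lam 2) v"
  let ?D = "double_removal_coeff c (lam 1) (lam 2) v"
  \<comment> \<open>In the variables \<open>p\<close>, \<open>q w\<close>, \<open>r w\<close> the
    Arnold relation \<open>arnold\<close> is the only relation needed, and the comparisons of
    coefficients become polynomial.\<close>
  define p where "p = g_fun c v u"
  define q where "q w = g_fun c u w" for w
  define r where "r w = g_fun c v w" for w
  have arnold: "p * q w = r w * (p + q w)" if "w \<in> S" for w
    unfolding p_def q_def r_def using that u by (intro g_fun_mult_g_fun) auto
  have f_eqs: "f_fun c v u = 1 + p" "f_fun c u v = 1 - p"
    using u by (simp_all add: f_fun_eq_g_fun p_def g_fun_swap[of c u v])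
  have f_eqs': "f_fun c u w = 1 + q w" "f_fun c w u = 1 - q w" "f_fun c v w = 1 + r w" "f_fun c w v = 1 - r w"
    if "w \<in> S" for w
  proof -
    have "u \<noteq> w" "v \<noteq> w"
      using that u by auto
    then show "f_fun c u w = 1 + q w" "f_fun c w u = 1 - q w" "f_fun c v w = 1 + r w" "f_fun c w v = 1 - r w"
      by (simp_all add: f_fun_eq_g_fun q_def r_def g_fun_swap[of c w])
  qed
  have split_w: "f_left c S x = f_fun c w x * f_left c (S - {w}) x" "f_right c x S = f_fun c x w * f_right c x (S - {w})"
    if "w \<in> S" for w x
    using that insert by (auto intro!: prod.remove)
  have "module_hom cscale (*) (\<psi> \<circ> T 1 2 u)"
    using T_hom insert.prems(1) by (rule module_hom_compose)
  from insert.IH[OF this \<open>v \<notin> S\<close>] have IH: "\<psi> (T 1 2 u (T 2 1 v (bethe S))) =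
    (\<Sum>w\<in>S. ?A S w * \<psi> (bethe (insert u (S - {w}))))
    + (\<Sum>w\<in>S. \<Sum>w'\<in>S - {w}. ?D (S - {w} - {w'}) w w' * \<psi> (bethe (insert u (insert v (S - {w} - {w'})))))"
    using insert u by (simp add: bethe_insert)
  \<comment> \<open>The coefficients of \<open>T11_T22_action\<close>, with \<open>u\<close> and
    \<open>v\<close> as arguments so that both orders are covered. Interchanging \<open>u\<close>
    and \<open>v\<close> also interchanges the target vectors: \<open>\<alpha> u v\<close> and
    \<open>\<beta> v u\<close> both belong to \<open>insert u (S - {w})\<close>.\<close>
  define \<alpha> where "\<alpha> u v w = lam 2 v * f_right c v S * g_fun c u w * lam 1 w * f_left c (S - {w}) w
        - g_fun c v w * lam 2 w * f_right c w (S - {w}) * g_fun c u v * lam 1 v * f_left c (S - {w}) v" for u v w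
  define \<beta> where "\<beta> u v w = g_fun c v w * lam 2 w * f_right c w (S - {w}) * lam 1 u * f_fun c v u * f_left c (S - {w}) u" for u v w
  define \<gamma> where "\<gamma> u v w w' = g_fun c v w' * lam 2 w' * f_right c w' (S - {w'}) * g_fun c u w * lam 1 w
        * f_fun c v w * f_left c (S - {w} - {w'}) w" for u v w w'
  have uv: "\<psi> (T 1 1 u (T 2 2 v (bethe S))) = lam 2 v * f_right c v S * lam 1 u * f_left c S u * \<psi> (bethe S)
    + (\<Sum>w\<in>S. \<alpha> u v w * \<psi> (bethe (insert u (S - {w})))) - (\<Sum>w\<in>S. \<beta> u v w * \<psi> (bethe (insert v (S - {w}))))
    - (\<Sum>w\<in>S. \<Sum>w'\<in>S - {w}. \<gamma> u v w w' * \<psi> (bethe (insert u (insert v (S - {w} - {w'})))))"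
    unfolding \<alpha>_def \<beta>_def \<gamma>_def using insert u by (intro T11_T22_action) auto
  have vu: "\<psi> (T 1 1 v (T 2 2 u (bethe S))) = lam 2 u * f_right c u S * lam 1 v * f_left c S v * \<psi> (bethe S)
    + (\<Sum>w\<in>S. \<alpha> v u w * \<psi> (bethe (insert v (S - {w})))) - (\<Sum>w\<in>S. \<beta> v u w * \<psi> (bethe (insert u (S - {w}))))
    - (\<Sum>w\<in>S. \<Sum>w'\<in>S - {w}. \<gamma> v u w w' * \<psi> (bethe (insert u (insert v (S - {w} - {w'})))))"
    unfolding \<alpha>_def \<beta>_def \<gamma>_def insert_commute[of u v] using insert u by (intro T11_T22_action) auto
  \<comment> \<open>Facts 1 to 4 compare the coefficients of the vectors on \<open>S\<close>,
    \<open>insert u (S - {w})\<close>, \<open>insert v (S - {w})\<close> and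
    \<open>insert u (insert v (S - {w} - {w'}))\<close>.\<close>
  have 1: "?A (insert u S) u = p * (lam 2 v * f_right c v S * lam 1 u * f_left c S u - lam 2 u * f_right c u S * lam 1 v * f_left c S v)"
    using u by (simp add: removal_coeff_def p_def mult_ac)
  have ins: "insert u S - {w} = insert u (S - {w})" if "w \<in> S" for w
    using that u by auto
  have 2: "?A (insert u S) w = ?A S w + p * (\<alpha> u v w + \<beta> v u w)" if w: "w \<in> S" for w
  proof -
    have "?A (insert u S) w = r w * (lam 1 w * lam 2 v * ((1 + q w) * f_left c (S - {w}) w) * ((1 + p) * f_right c v (S - {w}))
      - lam 1 v * lam 2 w * ((1 - q w) * f_right c w (S - {w})) * ((1 - p) * f_left c (S - {w}) v))"
      using insert w by (simp add: removal_coeff_def ins f_eqs f_eqs' r_def[symmetric])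
    moreover have "?A S w = r w * (lam 1 w * lam 2 v * f_left c (S - {w}) w * f_right c v (S - {w})
      - lam 1 v * lam 2 w * f_right c w (S - {w}) * f_left c (S - {w}) v)"
      by (simp add: removal_coeff_def r_def)
    moreover have "\<alpha> u v w = lam 2 v * ((1 + r w) * f_right c v (S - {w})) * q w * lam 1 w * f_left c (S - {w}) w
        + r w * lam 2 w * f_right c w (S - {w}) * p * lam 1 v * f_left c (S - {w}) v"
      unfolding \<alpha>_def split_w[OF w] f_eqs'[OF w] p_def q_def r_def g_fun_swap[of c u v] by simp
    moreover have "\<beta> v u w = q w * lam 2 w * f_right c w (S - {w}) * lam 1 v * (1 - p) * f_left c (S - {w}) v"
      by (simp add: \<beta>_def f_eqs q_def)
    ultimately show ?thesis
      using arnold[OF w] by algebra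
  qed
  \<comment> \<open>Removing the pair \<open>u\<close>, \<open>w\<close> in either order leaves the
    same vector, hence two double removal coefficients on the left.\<close>
  have 3: "?D (S - {w}) u w + ?D (S - {w}) w u = - p * (\<beta> u v w + \<alpha> v u w)" if w: "w \<in> S" for w
  proof -
    have "?D (S - {w}) u w = - (p * r w * lam 1 u * lam 2 w * (1 - q w) * f_left c (S - {w}) u * f_right c w (S - {w}))"
      "?D (S - {w}) w u = - (r w * p * lam 1 w * lam 2 u * (1 + q w) * f_left c (S - {w}) w * f_right c u (S - {w}))"
      using w by (simp_all add: double_removal_coeff_def f_eqs' p_def r_def)
    moreover have "\<beta> u v w = r w * lam 2 w * f_right c w (S - {w}) * lam 1 u * (1 + p) * f_left c (S - {w}) u"
      by (simp add: \<beta>_def f_eqs r_def)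
    moreover have "\<alpha> v u w = lam 2 u * ((1 + q w) * f_right c u (S - {w})) * r w * lam 1 w * f_left c (S - {w}) w
        - q w * lam 2 w * f_right c w (S - {w}) * p * lam 1 u * f_left c (S - {w}) u"
      unfolding \<alpha>_def split_w[OF w] f_eqs'[OF w] p_def q_def r_def by simp
    ultimately show ?thesis
      using arnold[OF w] by algebra
  qed
  have 4: "?D (insert u (S - {w} - {w'})) w w' = ?D (S - {w} - {w'}) w w' - p * (\<gamma> u v w w' - \<gamma> v u w w')"
    if w: "w \<in> S" "w' \<in> S - {w}" for w w'
  proof -
    define R where "R = S - {w} - {w'}"
    have R: "finite R" "u \<notin> R" "w \<notin> R" "S - {w'} = insert w R" and w': "w' \<in> S"
      using insert w by (auto simp: R_def)
    have "?D (insert u R) w w' = - (r w * r w' * lam 1 w * lam 2 w' * f_fun c w' w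
        * ((1 + q w) * f_left c R w) * ((1 - q w') * f_right c w' R))"
      using R w w' by (simp add: double_removal_coeff_def f_eqs' r_def)
    moreover have "?D R w w' = - (r w * r w' * lam 1 w * lam 2 w' * f_fun c w' w * f_left c R w * f_right c w' R)"
      by (simp add: double_removal_coeff_def r_def)
    moreover have "\<gamma> u v w w' = r w' * lam 2 w' * (f_fun c w' w * f_right c w' R) * q w * lam 1 w * (1 + r w) * f_left c R w"
      "\<gamma> v u w w' = q w' * lam 2 w' * (f_fun c w' w * f_right c w' R) * r w * lam 1 w * (1 + q w) * f_left c R w"
      unfolding \<gamma>_def R_def[symmetric] R(4) f_eqs'[OF w(1)] q_def r_def using R by simp_all
    ultimately show ?thesis
      unfolding R_def[symmetric] using arnold[OF w(1)] arnold[OF w'] by algebra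
  qed
  have D_insert: "(\<Sum>w'\<in>insert u S - {w}. ?D (insert u S - {w} - {w'}) w w' * \<psi> (bethe (insert v (insert u S - {w} - {w'}))))
    = ?D (S - {w}) w u * \<psi> (bethe (insert v (S - {w})))
    + (\<Sum>w'\<in>S - {w}. ?D (insert u (S - {w} - {w'})) w w' * \<psi> (bethe (insert u (insert v (S - {w} - {w'})))))"
    if w: "w \<in> S" for w
  proof -
    have "insert u (S - {w}) - {u} = S - {w}" "\<And>w'. w' \<in> S - {w} \<Longrightarrow> insert u (S - {w}) - {w'} = insert u (S - {w} - {w'})"
      using u by auto
    then show ?thesis
      unfolding ins[OF w] using insert u by (simp add: insert_commute)
  qed
  have double: "(\<Sum>w\<in>insert u S. \<Sum>w'\<in>insert u S - {w}. ?D (insert u S - {w} - {w'}) w w'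
        * \<psi> (bethe (insert v (insert u S - {w} - {w'}))))
    = (\<Sum>w\<in>S. (?D (S - {w}) u w + ?D (S - {w}) w u) * \<psi> (bethe (insert v (S - {w}))))
    + (\<Sum>w\<in>S. \<Sum>w'\<in>S - {w}. ?D (insert u (S - {w} - {w'})) w w' * \<psi> (bethe (insert u (insert v (S - {w} - {w'})))))"
    using insert u D_insert by (simp add: distrib_right sum.distrib)
  have single: "(\<Sum>w\<in>insert u S. ?A (insert u S) w * \<psi> (bethe (insert u S - {w})))
    = ?A (insert u S) u * \<psi> (bethe S) + (\<Sum>w\<in>S. ?A (insert u S) w * \<psi> (bethe (insert u (S - {w}))))"
    using insert u by (simp add: ins)
  have "\<psi> (T 2 1 v (bethe (insert u S))) = \<psi> (T 1 2 u (T 2 1 v (bethe S)))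
    + p * \<psi> (T 1 1 u (T 2 2 v (bethe S))) - p * \<psi> (T 1 1 v (T 2 2 u (bethe S)))"
    using insert u by (simp add: bethe_insert T21_T12 \<psi>.add \<psi>.diff \<psi>.scale p_def)
  also have "\<dots> = ?A (insert u S) u * \<psi> (bethe S)
    + (\<Sum>w\<in>S. ?A (insert u S) w * \<psi> (bethe (insert u (S - {w}))))
    + ((\<Sum>w\<in>S. (?D (S - {w}) u w + ?D (S - {w}) w u) * \<psi> (bethe (insert v (S - {w}))))
    + (\<Sum>w\<in>S. \<Sum>w'\<in>S - {w}. ?D (insert u (S - {w} - {w'})) w w' * \<psi> (bethe (insert u (insert v (S - {w} - {w'}))))))"
  proof -
    have "(\<Sum>w\<in>S. ?A (insert u S) w * X w) = (\<Sum>w\<in>S. ?A S w * X w) + p * (\<Sum>w\<in>S. \<alpha> u v w * X w) + p * (\<Sum>w\<in>S. \<beta> v u w * X w)" for X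
      unfolding sum_distrib_left sum.distrib[symmetric] by (intro sum.cong refl) (simp add: 2 algebra_simps)
    moreover have "(\<Sum>w\<in>S. (?D (S - {w}) u w + ?D (S - {w}) w u) * X w) = - p * (\<Sum>w\<in>S. \<beta> u v w * X w) - p * (\<Sum>w\<in>S. \<alpha> v u w * X w)" for X
      unfolding sum_distrib_left sum_subtractf[symmetric] by (intro sum.cong refl, subst 3) (simp_all add: algebra_simps)
    moreover have "(\<Sum>w\<in>S. \<Sum>w'\<in>S - {w}. ?D (insert u (S - {w} - {w'})) w w' * X w w')
      = (\<Sum>w\<in>S. \<Sum>w'\<in>S - {w}. ?D (S - {w} - {w'}) w w' * X w w') - p * (\<Sum>w\<in>S. \<Sum>w'\<in>S - {w}. \<gamma> u v w w' * X w w')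
        + p * (\<Sum>w\<in>S. \<Sum>w'\<in>S - {w}. \<gamma> v u w w' * X w w')" for X
      unfolding sum_distrib_left sum_subtractf[symmetric] sum.distrib[symmetric]
      by (intro sum.cong refl, subst 4) (simp_all add: algebra_simps)
    ultimately show ?thesis
      unfolding IH uv vu 1 by (simp only:) (simp add: algebra_simps)
  qed
  finally show ?case
    unfolding single double .
qed

section \<open>Scalar products\<close>

lemma off_shell_scalar_product:
  assumes "finite V" "finite S" "V \<inter> S = {}"
  shows "dual_bethe_vector T dual_vac V (bethe S) = korepin_sum c (lam 1) (lam 2) V S"
  using assms
proof (induction V arbitrary: S rule: finite_induct)
  case empty
  have "dual_vac (bethe S) = 0" if "S \<noteq> {}"
  proof -
    from \<open>S \<noteq> {}\<close> obtain u where u: "u \<in> S" by auto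
    then have "bethe S = T 1 2 u (bethe (S - {u}))"
      using empty bethe_insert[of "S - {u}" u] by (simp add: insert_absorb)
    then show ?thesis by (simp add: dual_vac_T12)
  qed
  then show ?case
    using empty by (auto simp: dual_bethe_vector_def korepin_sum_empty bethe_empty dual_vac_vac)
next
  case (insert v V)
  \<comment> \<open>Since the T21 commute, \<open>T 2 1 v\<close> can act on the Bethe vector first.
    The remaining operators followed by \<open>dual_vac\<close> form the functional to which
    \<open>T21_action\<close> is applied; the result is the recursion
    \<open>korepin_sum_insert\<close>.\<close>
  let ?\<psi> = "dual_bethe_vector T dual_vac V"
  have "module_hom cscale (*) dual_vac"
    using dual_vac_linear by (rule Vector_Spaces.linear.axioms(3))
  moreover have "module_hom cscale cscale (op_prod (T 2 1) V)"
    using insert by (intro op_prod_hom T_commute T_hom)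
  moreover have "?\<psi> = dual_vac \<circ> op_prod (T 2 1) V"
    by (simp add: dual_bethe_vector_def fun_eq_iff)
  ultimately have "module_hom cscale (*) ?\<psi>"
    by (simp add: module_hom_compose)
  moreover have "dual_bethe_vector T dual_vac (insert v V) (bethe S) = ?\<psi> (T 2 1 v (bethe S))"
    unfolding dual_bethe_vector_def using op_prod_insert(2)[of "T 2 1" V v, OF T_commute] insert by simp
  \<comment> \<open>All sets produced stay disjoint from \<open>V\<close>, also those containing
    \<open>v\<close>, because \<open>v\<close> is not in \<open>V\<close>.\<close>
  moreover have "?\<psi> (bethe (S - {w})) = korepin_sum c (lam 1) (lam 2) V (S - {w})"
    "?\<psi> (bethe (insert v (S - {w} - {w'}))) = korepin_sum c (lam 1) (lam 2) V (insert v (S - {w} - {w'}))" for w w'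
    using insert by (auto intro!: insert.IH)
  ultimately show ?case
    using insert by (simp add: T21_action korepin_sum_insert)
qed

lemma on_shell_scalar_product:
  assumes "finite V" "finite S" "V \<inter> S = {}" "bethe_equations c lam V"
  shows "dual_bethe_vector T dual_vac V (bethe S) = (\<Prod>v\<in>V. lam 2 v) * dwpf_expansion c (lam 1) (lam 2) V S"
proof -
  have nz: "f_fun c w v \<noteq> 0" if "v \<in> V" "w \<in> V - {v}" for v w
    using assms(4) that by (auto simp: bethe_equations_def)
  have "lam 1 v * f_left c (V - {v}) v = lam 2 v * f_right c v (V - {v})" if "v \<in> V" for v
  proof -
    have "lam 1 v / lam 2 v = f_right c v (V - {v}) / f_left c (V - {v}) v" "lam 2 v \<noteq> 0"
      using assms(4) that by (auto simp: bethe_equations_def prod_dividef)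
    moreover have "f_left c (V - {v}) v \<noteq> 0"
      using assms(1) nz that by auto
    ultimately show ?thesis
      by (simp add: field_simps)
  qed
  then show ?thesis
    unfolding off_shell_scalar_product[OF assms(1-3)] using assms(1) nz by (intro korepin_sum_on_shell)
qed

end

theorem theorem3p1:
  fixes cscale :: "complex \<Rightarrow> 'h::ab_group_add \<Rightarrow> 'h"
    and c :: complex
    and T :: "2 \<Rightarrow> 2 \<Rightarrow> complex \<Rightarrow> 'h \<Rightarrow> 'h"
    and vac :: 'h
    and dual_vac :: "'h \<Rightarrow> complex"
    and lam :: "2 \<Rightarrow> complex \<Rightarrow> complex"
    and n :: nat
    and U V :: "complex set"
    and vs :: "complex list"
  assumes "generalized_model cscale c T vac dual_vac lam"
    and "finite U" and "card U = n"
    and "distinct vs" and "set vs = V" and "card V = n"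
    and "U \<inter> V = {}"
  shows "op_prod (transfer_matrix T) V (bethe_vector T vac U)
           = (\<Sum>(\<eta>\<^sub>I, \<eta>\<^sub>I\<^sub>I) | \<eta>\<^sub>I \<union> \<eta>\<^sub>I\<^sub>I = U \<union> V \<and> \<eta>\<^sub>I \<inter> \<eta>\<^sub>I\<^sub>I = {} \<and> card \<eta>\<^sub>I = card \<eta>\<^sub>I\<^sub>I.
                cscale (multiple_action_coeff c lam vs \<eta>\<^sub>I \<eta>\<^sub>I\<^sub>I) (bethe_vector T vac \<eta>\<^sub>I\<^sub>I))
         \<and> (bethe_equations c lam V \<longrightarrow>
              dual_bethe_vector T dual_vac V (bethe_vector T vac U)
              = (\<Prod>v\<in>V. lam 2 v) * multiple_action_coeff c lam vs U V)"
proof (intro conjI impI)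
  interpret generalized_model cscale c T vac dual_vac lam
    by (fact assms(1))
  have fin: "finite V" "finite (U \<union> V)" and diff: "U \<union> V - V = U"
    and card: "card (U \<union> V) = 2 * n"
    using assms by (auto simp: card_Un_disjoint)
  \<comment> \<open>The union has 2n elements, so the two parts have equal size exactly when the
    second has n.\<close>
  have halves: "card \<eta>\<^sub>I = card \<eta>\<^sub>I\<^sub>I \<longleftrightarrow> card \<eta>\<^sub>I\<^sub>I = n" if "\<eta>\<^sub>I \<union> \<eta>\<^sub>I\<^sub>I = U \<union> V" "\<eta>\<^sub>I \<inter> \<eta>\<^sub>I\<^sub>I = {}" for \<eta>\<^sub>I \<eta>\<^sub>I\<^sub>I
  proof -
    have "finite \<eta>\<^sub>I" "finite \<eta>\<^sub>I\<^sub>I"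
      using fin(2) unfolding that(1)[symmetric] by auto
    then have "card \<eta>\<^sub>I + card \<eta>\<^sub>I\<^sub>I = 2 * n"
      unfolding card[symmetric] that(1)[symmetric] using that(2) by (rule card_Un_disjoint[symmetric])
    then show ?thesis by auto
  qed
  have "op_prod (transfer_matrix T) V (bethe_vector T vac U)
    = (\<Sum>S' | S' \<subseteq> U \<union> V \<and> card S' = n. cscale (iterated_coeff c lam vs U S') (bethe_vector T vac S'))"
    using multiple_action[of vs U "U \<union> V" n] assms fin by auto
  also have "\<dots> = (\<Sum>(\<eta>\<^sub>I, \<eta>\<^sub>I\<^sub>I) | \<eta>\<^sub>I \<union> \<eta>\<^sub>I\<^sub>I = U \<union> V \<and> \<eta>\<^sub>I \<inter> \<eta>\<^sub>I\<^sub>I = {} \<and> card \<eta>\<^sub>I = card \<eta>\<^sub>I\<^sub>I.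
                cscale (multiple_action_coeff c lam vs \<eta>\<^sub>I \<eta>\<^sub>I\<^sub>I) (bethe_vector T vac \<eta>\<^sub>I\<^sub>I))"
  \<comment> \<open>A partition is determined by its second part, and the complement of
    \<open>V\<close> in the union recovers the starting set \<open>U\<close>.\<close>
  proof (rule sum.reindex_bij_witness[where i = snd and j = "\<lambda>S'. (U \<union> V - S', S')"], goal_cases)
    case (2 S')
    then have "(U \<union> V - S') \<union> S' = U \<union> V" "(U \<union> V - S') \<inter> S' = {}"
      by auto
    with halves[OF this] 2 show ?case by simp
  next
    case (5 S')
    then have "(U \<union> V - S') \<union> S' = U \<union> V"
      by auto
    then show ?case
      using assms(5) diff by (simp add: multiple_action_coeff_def)
  qed (use halves in auto)
  finally show "op_prod (transfer_matrix T) V (bethe_vector T vac U)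
    = (\<Sum>(\<eta>\<^sub>I, \<eta>\<^sub>I\<^sub>I) | \<eta>\<^sub>I \<union> \<eta>\<^sub>I\<^sub>I = U \<union> V \<and> \<eta>\<^sub>I \<inter> \<eta>\<^sub>I\<^sub>I = {} \<and> card \<eta>\<^sub>I = card \<eta>\<^sub>I\<^sub>I.
         cscale (multiple_action_coeff c lam vs \<eta>\<^sub>I \<eta>\<^sub>I\<^sub>I) (bethe_vector T vac \<eta>\<^sub>I\<^sub>I))" .
  assume "bethe_equations c lam V"
  \<comment> \<open>Before the first action no parameter has been brought in: with
    \<open>P = {}\<close> the modifying products are 1 and the target set is
    \<open>V\<close>.\<close>
  moreover have "multiple_action_coeff c lam vs U V = dwpf_expansion c (lam 1) (lam 2) V U"
    using iterated_coeff_eq_dwpf_expansion[of "{}" U vs c lam] assms diff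
    by (auto simp: multiple_action_coeff_def)
  ultimately show "dual_bethe_vector T dual_vac V (bethe_vector T vac U)
      = (\<Prod>v\<in>V. lam 2 v) * multiple_action_coeff c lam vs U V"
    using on_shell_scalar_product[of V U] assms fin by auto
qed

end
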